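(* Let $\mathfrak g=\mathfrak g_1\times\mathfrak g_2$ be a decomposable finite-dimensional Lie algebra over a field of characteristic zero, with non-zero factors $\mathfrak g_1,\mathfrak g_2$, and suppose that the maximal gradings of $\mathfrak g_1$ and of $\mathfrak g_2$ do not have zero as a weight. Then the maximal grading of $\mathfrak g$ detects the product structure. That is, for a maximal grading $\mathfrak g=\bigoplus_{\alpha\in A}V_\alpha$ with set of weights $\Omega$, there is a partition $\Omega=\Omega_1\sqcup\Omega_2$ such that no edges exist between $\Omega_1$ and $\Omega_2$ in the graph associated with the grading, and such that $\mathfrak g$ is the direct product of the ideals $\bigoplus_{\alpha\in\Omega_1}V_\alpha$ and $\bigoplus_{\beta\in\Omega_2}V_\beta$, which are isomorphic to $\mathfrak g_1$ and $\mathfrak g_2$ respectively.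
   Context: A grading of a Lie algebra $\mathfrak g$ over an abelian group $A$ is a direct sum decomposition $\mathcal V:\mathfrak g=\bigoplus_{\alpha\in A}V_\alpha$ into subspaces (layers) with $[V_\alpha,V_\beta]\subset V_{\alpha+\beta}$ for all $\alpha,\beta\in A$; its weights are the $\alpha$ with $V_\alpha\ne0$. For a homomorphism $f:A\to B$ of abelian groups, the push-forward $f_*\mathcal V$ is the $B$-grading with layers $\bigoplus_{\alpha\in f^{-1}(\beta)}V_\alpha$. The graph associated with a grading with set of weights $\Omega$ has vertex set $\Omega$, and whenever $[V_\alpha,V_\beta]\ne0$ there are edges between all three of the vertices $\alpha,\beta,\alpha+\beta\in\Omega$. A realization of an $A$-grading $\mathcal V$ with set of weights $\Omega$ is a grading $\mathcal W$ over an abelian group $B$ such that, for some injective map $f:\Omega\to B$, $W_{f(\alpha)}=V_\alpha$ for all $\alpha\in\Omega$ (and all other layers are zero). A universal realization of $\mathcal V$ is a realization $\widetilde{\mathcal V}$ over some abelian group $A$ such that for every realization of $\mathcal V$ as a $B$-grading there is a unique homomorphism $f:A\to B$ such that this $B$-grading equals $f_*\widetilde{\mathcal V}$. A split torus of $\operatorname{der}(\mathfrak g)$ is an abelian subalgebra of $\operatorname{der}(\mathfrak g)$ that is simultaneously diagonalizable over the base field of $\mathfrak g$. The grading induced by a split torus $\mathfrak t$ is the $\mathfrak t^*$-grading with layers $V_\alpha=\{X\in\mathfrak g:\delta(X)=\alpha(\delta)X\ \forall\delta\in\mathfrak t\}$, $\alpha\in\mathfrak t^*$. A maximal grading of $\mathfrak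 g$ is the universal realization of the grading induced by a maximal split torus of $\operatorname{der}(\mathfrak g)$. The maximal grading is unique up to equivalence, i.e. up to an automorphism of $\mathfrak g$ and an isomorphism of grading groups.
   Formalization: Added hypothesis: for at least one of the two factors, the maximal grading has no non-zero weight of finite order. Without it the claim fails, e.g. for the square of a 20-dimensional nilpotent algebra whose maximal grading group is Z^5 x Z/2 and has a weight of order two. *)

theory Defs
  imports
    "HOL-Analysis.Product_Vector"
    "HOL-Library.FuncSet"
    "HOL-Library.Infinite_Typeclass"
    "HOL-Algebra.Group"
begin

locale lie_algebra = vector_space scale
  for scale :: "'k::field \<Rightarrow> 'a::ab_group_add \<Rightarrow> 'a" +
  fixes bracket :: "'a \<Rightarrow> 'a \<Rightarrow> 'a"
  assumes bracket_add_left: "bracket (x + y) z = bracket x z + bracket y z"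
    and bracket_add_right: "bracket x (y + z) = bracket x y + bracket x z"
    and bracket_scale_left: "bracket (scale c x) y = scale c (bracket x y)"
    and bracket_scale_right: "bracket x (scale c y) = scale c (bracket x y)"
    and bracket_self: "bracket x x = 0"
    and jacobi: "bracket x (bracket y z) + bracket y (bracket z x) + bracket z (bracket x y) = 0"
begin

subsection \<open>Gradings\<close>

text \<open>Grading groups are written multiplicatively (HOL-Algebra): the weight zero is \<open>\<one>\<^bsub>A\<^esub>\<close>,
  and \<open>\<alpha> + \<beta>\<close> is \<open>\<alpha> \<otimes>\<^bsub>A\<^esub> \<beta>\<close>. The values of a family of layers outside \<open>carrier A\<close> are
  irrelevant.\<close>

definition direct_sum_of :: "'i set \<Rightarrow> ('i \<Rightarrow> 'a set) \<Rightarrow> bool"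
  where "direct_sum_of I V \<longleftrightarrow>
    (\<forall>i\<in>I. subspace (V i)) \<and>
    (\<forall>x. \<exists>!f. (\<forall>i\<in>I. f i \<in> V i) \<and> (\<forall>i. i \<notin> I \<longrightarrow> f i = 0) \<and>
               finite {i. f i \<noteq> 0} \<and> x = (\<Sum>i | f i \<noteq> 0. f i))"

definition grading :: "'g monoid \<Rightarrow> ('g \<Rightarrow> 'a set) \<Rightarrow> bool"
  where "grading A V \<longleftrightarrow> comm_group A \<and> direct_sum_of (carrier A) V \<and>
    (\<forall>\<alpha>\<in>carrier A. \<forall>\<beta>\<in>carrier A. \<forall>x\<in>V \<alpha>. \<forall>y\<in>V \<beta>. bracket x y \<in> V (\<alpha> \<otimes>\<^bsub>A\<^esub> \<beta>))"

definition weights :: "'g monoid \<Rightarrow> ('g \<Rightarrow> 'a set) \<Rightarrow> 'g set"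
  where "weights A V = {\<alpha> \<in> carrier A. V \<alpha> \<noteq> {0}}"

definition sum_of_layers :: "('g \<Rightarrow> 'a set) \<Rightarrow> 'g set \<Rightarrow> 'a set"
  where "sum_of_layers V S = span (\<Union>\<alpha>\<in>S. V \<alpha>)"

definition push_forward :: "'g monoid \<Rightarrow> ('g \<Rightarrow> 'h) \<Rightarrow> ('g \<Rightarrow> 'a set) \<Rightarrow> 'h \<Rightarrow> 'a set"
  where "push_forward A f V \<beta> = sum_of_layers V {\<alpha> \<in> carrier A. f \<alpha> = \<beta>}"

definition edges :: "'g monoid \<Rightarrow> ('g \<Rightarrow> 'a set) \<Rightarrow> 'g set set"
  where "edges A V =
    {{\<mu>, \<nu>} | \<mu> \<nu>. \<mu> \<noteq> \<nu> \<and>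
      (\<exists>\<alpha>\<in>weights A V. \<exists>\<beta>\<in>weights A V.
         (\<exists>x\<in>V \<alpha>. \<exists>y\<in>V \<beta>. bracket x y \<noteq> 0) \<and>
         \<mu> \<in> {\<alpha>, \<beta>, \<alpha> \<otimes>\<^bsub>A\<^esub> \<beta>} \<and> \<nu> \<in> {\<alpha>, \<beta>, \<alpha> \<otimes>\<^bsub>A\<^esub> \<beta>})}"

definition realization :: "'g monoid \<Rightarrow> ('g \<Rightarrow> 'a set) \<Rightarrow> 'h monoid \<Rightarrow> ('h \<Rightarrow> 'a set) \<Rightarrow> bool"
  where "realization A V B W \<longleftrightarrow> grading B W \<and>
    (\<exists>f. inj_on f (weights A V) \<and> f ` weights A V \<subseteq> carrier B \<and>
         (\<forall>\<alpha>\<in>weights A V. W (f \<alpha>) = V \<alpha>) \<and>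
         (\<forall>\<beta>\<in>carrier B - f ` weights A V. W \<beta> = {0}))"

text \<open>HOL cannot quantify over all abelian groups inside a formula, so the groups \<open>U\<close> and \<open>B\<close>
  below have carriers in one arbitrary infinite type \<open>'u\<close>. For finite-dimensional algebras, which
  have finitely many weights, the choice of \<open>'u\<close> does not matter: the weights of \<open>B\<close> generate a
  countable subgroup, a copy of which lives in \<open>'u\<close>, so existence of the homomorphism follows for
  groups \<open>B\<close> of any size; and comparing with \<open>\<langle>weights\<rangle> \<times> \<rat>/\<int>\<close>, again countable, shows that \<open>U\<close>
  is generated by its weights, so uniqueness follows as well. Homomorphisms are taken in
  \<open>extensional (carrier U)\<close> because \<open>hom\<close> does not restrict values outside the carrier.\<close>

definition universal_realization ::
    "'g monoid \<Rightarrow> ('g \<Rightarrow> 'a set) \<Rightarrow> 'u::infinite monoid \<Rightarrow> ('u \<Rightarrow> 'a set) \<Rightarrow> bool"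
  where "universal_realization A V U V' \<longleftrightarrow> realization A V U V' \<and>
    (\<forall>(B::'u monoid) W. realization A V B W \<longrightarrow>
      (\<exists>!f. f \<in> hom U B \<inter> extensional (carrier U) \<and>
            (\<forall>\<beta>\<in>carrier B. W \<beta> = push_forward U f V' \<beta>)))"

subsection \<open>Split tori and maximal gradings\<close>

definition derivations :: "('a \<Rightarrow> 'a) set"
  where "derivations = {\<delta>. Vector_Spaces.linear scale scale \<delta> \<and>
    (\<forall>x y. \<delta> (bracket x y) = bracket (\<delta> x) y + bracket x (\<delta> y))}"

text \<open>The bracket of derivations is the commutator; on a subset closed under zero it is enough to
  ask that it vanishes for the subset to be an abelian subalgebra.\<close>

definition split_torus :: "('a \<Rightarrow> 'a) set \<Rightarrow> bool"
  where "split_torus T \<longleftrightarrow>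
    T \<subseteq> derivations \<and>
    (\<lambda>x. 0) \<in> T \<and>
    (\<forall>\<delta>\<in>T. \<forall>\<epsilon>\<in>T. (\<lambda>x. \<delta> x + \<epsilon> x) \<in> T) \<and>
    (\<forall>c. \<forall>\<delta>\<in>T. (\<lambda>x. scale c (\<delta> x)) \<in> T) \<and>
    (\<forall>\<delta>\<in>T. \<forall>\<epsilon>\<in>T. \<forall>x. \<delta> (\<epsilon> x) - \<epsilon> (\<delta> x) = 0) \<and>
    (\<exists>E. independent E \<and> span E = UNIV \<and> (\<forall>e\<in>E. \<forall>\<delta>\<in>T. \<exists>c. \<delta> e = scale c e))"

definition maximal_split_torus :: "('a \<Rightarrow> 'a) set \<Rightarrow> bool"
  where "maximal_split_torus T \<longleftrightarrow>
    split_torus T \<and> (\<forall>T'. split_torus T' \<longrightarrow> T \<subseteq> T' \<longrightarrow> T' = T)"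

definition dual_group :: "('a \<Rightarrow> 'a) set \<Rightarrow> (('a \<Rightarrow> 'a) \<Rightarrow> 'k) monoid"
  where "dual_group T =
    \<lparr>carrier = {\<alpha> \<in> extensional T.
        (\<forall>\<delta>\<in>T. \<forall>\<epsilon>\<in>T. \<alpha> (\<lambda>x. \<delta> x + \<epsilon> x) = \<alpha> \<delta> + \<alpha> \<epsilon>) \<and>
        (\<forall>c. \<forall>\<delta>\<in>T. \<alpha> (\<lambda>x. scale c (\<delta> x)) = c * \<alpha> \<delta>)},
     monoid.mult = (\<lambda>\<alpha> \<beta>. \<lambda>\<delta>\<in>T. \<alpha> \<delta> + \<beta> \<delta>),
     one = (\<lambda>\<delta>\<in>T. 0)\<rparr>"

definition torus_layer :: "('a \<Rightarrow> 'a) set \<Rightarrow> (('a \<Rightarrow> 'a) \<Rightarrow> 'k) \<Rightarrow> 'a set"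
  where "torus_layer T \<alpha> = {x. \<forall>\<delta>\<in>T. \<delta> x = scale (\<alpha> \<delta>) x}"

definition maximal_grading :: "'u::infinite monoid \<Rightarrow> ('u \<Rightarrow> 'a set) \<Rightarrow> bool"
  where "maximal_grading A V \<longleftrightarrow>
    (\<exists>T. maximal_split_torus T \<and> universal_realization (dual_group T) (torus_layer T) A V)"

text \<open>The universal group of the grading induced by a maximal split torus \<open>T\<close> can have torsion, and
  then a layer on which \<open>T\<close> acts by zero can have a non-zero weight of finite order. Example:
  take the Lie algebra with basis \<open>x, y, z, s\<^sub>1, \<dots>, s\<^sub>4, c\<close> and brackets \<open>[x,y] = z\<close>,
  \<open>[s\<^sub>1,s\<^sub>4] = [s\<^sub>2,s\<^sub>3] = c\<close>, acting through its abelianization on the abelian ideal \<open>M\<close> with module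
  generators \<open>P, Q\<close>, relations \<open>s\<^sub>1 P = s\<^sub>2 y\<^sup>2 Q\<close>, \<open>s\<^sub>3 x\<^sup>2 P = s\<^sub>4 Q\<close>, and with all monomials zero that
  do not divide (in the \<open>P\<close> or \<open>Q\<close> part) one of these four. Its universal group is \<open>\<int>\<^sup>5 \<times> \<int>/2\<close>, and \<open>z\<close> has
  weight of order two. Zero is not a weight here, but the product of two copies has a connected
  graph. The next condition excludes this; it is automatic if \<open>A\<close> is torsion-free.\<close>

definition no_nonzero_torsion_weight :: "'g monoid \<Rightarrow> ('g \<Rightarrow> 'a set) \<Rightarrow> bool"
  where "no_nonzero_torsion_weight A V \<longleftrightarrow>
    (\<forall>\<alpha>\<in>weights A V. \<forall>n::nat. n > 0 \<and> \<alpha> [^]\<^bsub>A\<^esub> n = \<one>\<^bsub>A\<^esub> \<longrightarrow> \<alpha> = \<one>\<^bsub>A\<^esub>)"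

subsection \<open>Ideals and products\<close>

definition lie_ideal :: "'a set \<Rightarrow> bool"
  where "lie_ideal I \<longleftrightarrow> subspace I \<and> (\<forall>x. \<forall>y\<in>I. bracket x y \<in> I)"

definition direct_product_of_ideals :: "'a set \<Rightarrow> 'a set \<Rightarrow> bool"
  where "direct_product_of_ideals I J \<longleftrightarrow>
    lie_ideal I \<and> lie_ideal J \<and> I \<inter> J = {0} \<and> (\<forall>x. \<exists>y\<in>I. \<exists>z\<in>J. x = y + z)"

end

definition lie_isomorphic_to_ideal ::
    "('k::field \<Rightarrow> 'b::ab_group_add \<Rightarrow> 'b) \<Rightarrow> ('b \<Rightarrow> 'b \<Rightarrow> 'b) \<Rightarrow>
     ('k \<Rightarrow> 'a::ab_group_add \<Rightarrow> 'a) \<Rightarrow> ('a \<Rightarrow> 'a \<Rightarrow> 'a) \<Rightarrow> 'a set \<Rightarrow> bool"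
  where "lie_isomorphic_to_ideal s' b' s b I \<longleftrightarrow>
    (\<exists>\<phi>. Vector_Spaces.linear s' s \<phi> \<and>
         (\<forall>x y. \<phi> (b' x y) = b (\<phi> x) (\<phi> y)) \<and>
         bij_betw \<phi> UNIV I)"

definition prod_bracket ::
    "('a \<Rightarrow> 'a \<Rightarrow> 'a) \<Rightarrow> ('b \<Rightarrow> 'b \<Rightarrow> 'b) \<Rightarrow> 'a \<times> 'b \<Rightarrow> 'a \<times> 'b \<Rightarrow> 'a \<times> 'b"
  where "prod_bracket b\<^sub>1 b\<^sub>2 x y = (b\<^sub>1 (fst x) (fst y), b\<^sub>2 (snd x) (snd y))"

lemma lie_algebra_prod:
  assumes "lie_algebra s\<^sub>1 b\<^sub>1" and "lie_algebra s\<^sub>2 b\<^sub>2"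
  shows "lie_algebra (module_prod.scale s\<^sub>1 s\<^sub>2) (prod_bracket b\<^sub>1 b\<^sub>2)"
proof -
  interpret L1: lie_algebra s\<^sub>1 b\<^sub>1 by fact
  interpret L2: lie_algebra s\<^sub>2 b\<^sub>2 by fact
  interpret vector_space_prod s\<^sub>1 s\<^sub>2 ..
  show ?thesis
    by unfold_locales
      (simp_all add: prod_bracket_def scale_def zero_prod_def
        L1.bracket_add_left L1.bracket_add_right L1.bracket_scale_left L1.bracket_scale_right
        L1.bracket_self L1.jacobi
        L2.bracket_add_left L2.bracket_add_right L2.bracket_scale_left L2.bracket_scale_right
        L2.bracket_self L2.jacobi)
qed

end

theory Submission
  imports Defs "HOL-Algebra.Free_Abelian_Groups" "HOL-Algebra.Weak_Morphisms"
    "HOL-Library.Function_Algebras"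
begin

text \<open>Let \<open>T\<close> be the given maximal split torus. The projection \<open>e\<close> of \<open>\<gg>\<close> onto \<open>\<gg>\<^sub>1\<close> is an idempotent of
  the centroid, and \<open>[D,e]\<close> is, for every derivation \<open>D\<close>, a map that kills the derived algebra and
  has central values. This replaces the conjugacy of maximal tori: once \<open>e\<close> has been made
  compatible with \<open>T\<close> on a complement, inside the center, of the central part of the derived
  algebra, the weight zero part of \<open>e\<close> differs from \<open>e\<close> by an element of a square-zero ideal of the centroid, so that
  lifting idempotents yields an automorphism \<open>\<Phi>\<close> of \<open>\<gg>\<close> for which \<open>\<Phi> e \<Phi>\<^sup>-\<^sup>1\<close> commutes with \<open>T\<close>.
  Then \<open>T\<close> is the product of maximal split tori \<open>T\<^sub>1, T\<^sub>2\<close> of the factors \<open>\<Phi>(\<gg>\<^sub>1), \<Phi>(\<gg>\<^sub>2)\<close>.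
  A layer of \<open>T\<close> contained in neither factor contains a vector whose two components are non-zero, and
  they are killed by \<open>T\<^sub>1\<close> and \<open>T\<^sub>2\<close>. A vector killed by \<open>T\<^sub>i\<close> has a torsion weight in the universal
  realization, since additive functions from the universal group to the base field define
  derivations in \<open>T\<^sub>i\<close>. The hypotheses exclude this for one of the factors.\<close>

section \<open>Simultaneous eigenspaces\<close>

text \<open>The obstacle is that \<open>T\<close> need not respect the given factors: a derivation
  may send one factor into the center of the other. Two central-valued maps that kill the derived
  algebra compose to zero if the center lies in the derived algebra, but an abelian direct factor
  can spoil this. Aligning the idempotent with \<open>T\<close> on the center makes the error
  \<open>k\<close> between it and its weight zero part vanish on the whole center, so that
  \<open>k (k x) = 0\<close> and \<open>k (e (k x)) = 0\<close>. The lifting is then given by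
  explicit formulas over any field of characteristic zero, without passing to an algebraic closure.
  The torsion condition comes from duality. Rational functions on the weights that are additive
  along non-zero brackets take values in the base field, hence give elements of a maximal torus; but
  such functions see an abelian group only up to torsion. So a vector killed by the torus is known
  to have finite order in the universal group, not to have trivial weight. A mixed layer produces
  such a vector in both factors at once, which is why excluding torsion in one of them is
  enough.\<close>

locale fd_lie_algebra = lie_algebra scale bracket + finite_dimensional_vector_space scale Basis
  for scale :: "'k::field_char_0 \<Rightarrow> 'a::ab_group_add \<Rightarrow> 'a"
    and bracket :: "'a \<Rightarrow> 'a \<Rightarrow> 'a" and Basis :: "'a set"
begin

sublocale endo: vector_space_pair scale scale
  by unfold_locales

abbreviation lin :: "('a \<Rightarrow> 'a) \<Rightarrow> bool"
  where "lin \<equiv> Vector_Spaces.linear scale scale"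

lemma linI:
  assumes "\<And>x y. f (x + y) = f x + f y" and "\<And>c x. f (scale c x) = scale c (f x)"
  shows "lin f"
  using assms vector_space_axioms by (auto simp: Vector_Spaces.linear_iff)

lemmas lin_simps = endo.linear_add endo.linear_scale endo.linear_diff endo.linear_neg
  endo.linear_0 endo.linear_sum

lemma bracket_zero_left [simp]: "bracket 0 y = 0"
  using bracket_scale_left[of 0 0 y] by simp

lemma bracket_zero_right [simp]: "bracket x 0 = 0"
  using bracket_scale_right[of x 0 0] by simp

lemma lin_bracket_right: "lin (bracket x)"
  by (rule linI) (simp_all add: bracket_add_right bracket_scale_right)

lemma lin_bracket_left: "lin (\<lambda>x. bracket x y)"
  by (rule linI) (simp_all add: bracket_add_left bracket_scale_left)

lemma bracket_diff_left: "bracket (x - y) z = bracket x z - bracket y z"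
  using lin_simps(3)[OF lin_bracket_left] .

lemma bracket_diff_right: "bracket x (y - z) = bracket x y - bracket x z"
  using lin_simps(3)[OF lin_bracket_right] .

lemma bracket_sum_left: "bracket (sum f S) y = (\<Sum>i\<in>S. bracket (f i) y)"
  using lin_simps(6)[OF lin_bracket_left] .

lemma bracket_sum_right: "bracket x (sum f S) = (\<Sum>i\<in>S. bracket x (f i))"
  using lin_simps(6)[OF lin_bracket_right] .

lemma bracket_antisym: "bracket y x = - bracket x y"
proof -
  have "bracket (x + y) (x + y) = bracket x y + bracket y x"
    by (simp only: bracket_add_left bracket_add_right) (simp add: bracket_self)
  then have "bracket x y + bracket y x = 0"
    by (simp only: bracket_self)
  then show ?thesis
    by (simp add: eq_neg_iff_add_eq_0 add.commute)
qed

end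

locale diag_family = fd_lie_algebra scale bracket Basis
  for scale :: "'k::field_char_0 \<Rightarrow> 'a::ab_group_add \<Rightarrow> 'a"
    and bracket :: "'a \<Rightarrow> 'a \<Rightarrow> 'a" and Basis :: "'a set" +
  fixes F :: "('a \<Rightarrow> 'a) set" and E :: "'a set"
  assumes lin_F: "D \<in> F \<Longrightarrow> lin D"
    and indep_E: "independent E" and span_E: "span E = UNIV"
    and eigen_E: "b \<in> E \<Longrightarrow> D \<in> F \<Longrightarrow> \<exists>c. D b = scale c b"
begin

text \<open>Restricting to \<open>F\<close> makes this an extensional function, so that two
  different weights are told apart by some member of \<open>F\<close>. It also matches the carrier
  of \<open>dual_group\<close>.\<close>

definition weight :: "'a \<Rightarrow> ('a \<Rightarrow> 'a) \<Rightarrow> 'k"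
  where "weight b = (\<lambda>D\<in>F. SOME c. D b = scale c b)"

definition layer_proj :: "(('a \<Rightarrow> 'a) \<Rightarrow> 'k) \<Rightarrow> 'a \<Rightarrow> 'a"
  where "layer_proj \<alpha> x = (\<Sum>b | b \<in> E \<and> weight b = \<alpha>. scale (representation E x b) b)"

lemma finite_E: "finite E"
  by (rule finiteI_independent[OF indep_E])

lemma weight_eigen: "b \<in> E \<Longrightarrow> D \<in> F \<Longrightarrow> D b = scale (weight b D) b"
  unfolding weight_def using someI_ex[OF eigen_E] by simp

lemma weight_extensional: "weight b \<in> extensional F"
  by (simp add: weight_def)

lemma expand: "x = (\<Sum>b\<in>E. scale (representation E x b) b)"
  using sum_representation_eq[OF indep_E _ finite_E order_refl, of x] by (simp add: span_E)

lemma repr_unique: "representation E (\<Sum>b\<in>E. scale (r b) b) b' = (if b' \<in> E then r b' else 0)"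
proof -
  have "representation E (\<Sum>b\<in>E. scale (r b) b) = (\<lambda>b'. if b' \<in> E then r b' else 0)"
  proof (rule representation_eqI[OF indep_E])
    show "finite {b. (if b \<in> E then r b else 0) \<noteq> 0}"
      by (rule finite_subset[OF _ finite_E]) (auto split: if_splits)
    show "(\<Sum>b | (if b \<in> E then r b else 0) \<noteq> 0. scale (if b \<in> E then r b else 0) b)
        = (\<Sum>b\<in>E. scale (r b) b)"
      by (rule sum.mono_neutral_cong_left) (auto simp: finite_E split: if_splits)
  qed (auto simp: span_E split: if_splits)
  then show ?thesis by simp
qed

lemma repr_apply:
  assumes "D \<in> F" "b \<in> E"
  shows "representation E (D x) b = weight b D * representation E x b"
proof -
  have "D x = (\<Sum>b\<in>E. scale (weight b D * representation E x b) b)"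
    by (subst expand[of x])
      (simp add: lin_simps[OF lin_F] assms weight_eigen mult.commute)
  then show ?thesis
    using repr_unique assms by simp
qed

lemma lin_layer_proj: "lin (layer_proj \<alpha>)"
  by (rule linI) (simp_all add: layer_proj_def span_E indep_E representation_add
      representation_scale scale_left_distrib sum.distrib scale_sum_right)

lemma subspace_layer: "subspace (torus_layer F \<alpha>)"
  by (rule subspaceI)
    (auto simp: torus_layer_def lin_simps[OF lin_F] scale_right_distrib mult.commute)

lemma layer_proj_in: "layer_proj \<alpha> x \<in> torus_layer F \<alpha>"
  unfolding layer_proj_def
  by (rule subspace_sum[OF subspace_layer])
    (auto intro!: subspace_scale[OF subspace_layer] simp: torus_layer_def weight_eigen lin_simps[OF lin_F] mult.commute)

text \<open>Some \<open>D\<close> in \<open>F\<close> takes different values under the two weights.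
  It multiplies the coefficient of \<open>b\<close> by \<open>weight b D\<close>, because
  \<open>b\<close> is an eigenvector, and by \<open>\<alpha> D\<close>, because \<open>x\<close> is
  one, so the coefficient is zero.\<close>

lemma repr_layer:
  assumes "x \<in> torus_layer F \<alpha>" "\<alpha> \<in> extensional F" "b \<in> E" "weight b \<noteq> \<alpha>"
  shows "representation E x b = 0"
proof -
  obtain D where D: "D \<in> F" "weight b D \<noteq> \<alpha> D"
    using assms extensionalityI[OF weight_extensional, of \<alpha>] by blast
  have "D x = scale (\<alpha> D) x"
    using assms D by (simp add: torus_layer_def)
  then have "weight b D * representation E x b = \<alpha> D * representation E x b"
    using repr_apply[OF D(1) assms(3), of x] fun_cong[OF representation_scale[OF indep_E, of x "\<alpha> D"], of b]
    by (auto simp: span_E)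
  then have "(weight b D - \<alpha> D) * representation E x b = 0" by (simp add: left_diff_distrib)
  then show ?thesis using D(2) by simp
qed

lemma layer_proj_id:
  assumes "x \<in> torus_layer F \<alpha>" "\<alpha> \<in> extensional F"
  shows "layer_proj \<alpha> x = x"
proof -
  have "x = (\<Sum>b\<in>E. scale (representation E x b) b)" by (rule expand)
  also have "\<dots> = layer_proj \<alpha> x"
    unfolding layer_proj_def
    by (rule sum.mono_neutral_right) (auto simp: finite_E repr_layer[OF assms])
  finally show ?thesis by simp
qed

lemma layer_proj_other:
  assumes "x \<in> torus_layer F \<alpha>" "\<alpha> \<in> extensional F" "\<beta> \<noteq> \<alpha>"
  shows "layer_proj \<beta> x = 0"
  unfolding layer_proj_def by (rule sum.neutral) (auto simp: repr_layer[OF assms(1,2)] assms(3))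

lemma layer_proj_outside: "\<alpha> \<notin> weight ` E \<Longrightarrow> layer_proj \<alpha> x = 0"
  unfolding layer_proj_def by (rule sum.neutral) auto

lemma sum_layer_proj: "(\<Sum>\<alpha>\<in>weight ` E. layer_proj \<alpha> x) = x"
proof -
  have "(\<Sum>\<alpha>\<in>weight ` E. layer_proj \<alpha> x) = (\<Sum>b\<in>E. scale (representation E x b) b)"
    unfolding layer_proj_def by (rule sum.group) (auto simp: finite_E)
  then show ?thesis using expand[of x] by simp
qed

lemma layer_proj_apply:
  assumes "D \<in> F" shows "layer_proj \<alpha> (D x) = scale (\<alpha> D) (layer_proj \<alpha> x)"
  unfolding layer_proj_def scale_sum_right
  by (rule sum.cong) (auto simp: repr_apply assms)

lemma apply_layer_proj:
  "D \<in> F \<Longrightarrow> D (layer_proj \<alpha> x) = scale (\<alpha> D) (layer_proj \<alpha> x)"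
  using layer_proj_in[of \<alpha> x] by (simp add: torus_layer_def)

text \<open>Induction on a finite set \<open>W\<close> outside which \<open>x\<close> has no
  components. Subtracting \<open>\<beta> D\<close> times the identity from \<open>D\<close> gives an
  operator that removes the component at \<beta> and multiplies the one at \<gamma> by a non-zero
  scalar, so the other components come from the smaller set; the component at \<beta> is what then
  remains of \<open>x\<close>.\<close>

lemma layer_proj_stable_aux:
  assumes S: "subspace S" and stable: "\<And>D x. D \<in> F \<Longrightarrow> x \<in> S \<Longrightarrow> D x \<in> S"
    and "finite W" "x \<in> S" "\<And>\<beta>. \<beta> \<notin> W \<Longrightarrow> layer_proj \<beta> x = 0"
  shows "layer_proj \<alpha> x \<in> S"
  using assms(3-)
proof (induction W arbitrary: x \<alpha> rule: finite_induct)
  case empty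
  then show ?case using subspace_0[OF S] by simp
next
  case (insert \<beta> W)
  have others: "layer_proj \<gamma> x \<in> S" if "\<gamma> \<noteq> \<beta>" for \<gamma>
  \<comment> \<open>A separating \<open>D\<close> in \<open>F\<close> exists for extensional
    functions. If one of the two is not the weight of a basis vector, its component is zero, and
    either the claim is trivial or the smaller set already works for \<open>x\<close>.\<close>
  proof (cases "\<gamma> \<in> weight ` E \<and> \<beta> \<in> weight ` E")
    case True
    then have "\<gamma> \<in> extensional F" "\<beta> \<in> extensional F"
      using weight_extensional by auto
    with that obtain D where D: "D \<in> F" "\<gamma> D \<noteq> \<beta> D"
      using extensionalityI[of \<gamma> F \<beta>] by blast
    define y where "y = D x - scale (\<beta> D) x"
    have proj_y: "layer_proj \<delta> y = scale (\<delta> D - \<beta> D) (layer_proj \<delta> x)" for \<delta>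
      by (simp add: y_def lin_simps[OF lin_layer_proj] layer_proj_apply D scale_left_diff_distrib)
    have "layer_proj \<gamma> y \<in> S"
    proof (rule insert.IH)
      show "y \<in> S"
        unfolding y_def using stable D insert.prems S by (intro subspace_diff subspace_scale) auto
      show "layer_proj \<delta> y = 0" if "\<delta> \<notin> W" for \<delta>
        using insert.prems(2)[of \<delta>] that by (cases "\<delta> = \<beta>") (auto simp: proj_y)
    qed
    then have "scale (inverse (\<gamma> D - \<beta> D)) (layer_proj \<gamma> y) \<in> S"
      by (rule subspace_scale[OF S])
    then show ?thesis using D by (simp add: proj_y)
  next
    case False
    show ?thesis
    proof (cases "\<gamma> \<in> weight ` E")
      case True
      with False have "layer_proj \<beta> x = 0" by (simp add: layer_proj_outside)
      then have "layer_proj \<delta> x = 0" if "\<delta> \<notin> W" for \<delta>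
        using insert.prems(2)[of \<delta>] that by (cases "\<delta> = \<beta>") auto
      then show ?thesis
        using insert.IH[OF insert.prems(1)] by blast
    qed (simp add: layer_proj_outside subspace_0[OF S])
  qed
  show ?case
  proof (cases "\<alpha> = \<beta> \<and> \<beta> \<in> weight ` E")
    case True
    have "x = layer_proj \<beta> x + (\<Sum>\<gamma>\<in>weight ` E - {\<beta>}. layer_proj \<gamma> x)"
      by (subst sum.remove[symmetric]) (auto simp: finite_E True sum_layer_proj)
    then have "layer_proj \<beta> x = x - (\<Sum>\<gamma>\<in>weight ` E - {\<beta>}. layer_proj \<gamma> x)"
      by (simp add: eq_diff_eq)
    also have "\<dots> \<in> S"
      using others insert.prems by (auto intro!: subspace_diff[OF S] subspace_sum[OF S])
    finally show ?thesis using True by simp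
  next
    case False
    then show ?thesis using others layer_proj_outside subspace_0[OF S] by metis
  qed
qed

lemma layer_proj_stable:
  assumes "subspace S" and "\<And>D x. D \<in> F \<Longrightarrow> x \<in> S \<Longrightarrow> D x \<in> S" and "x \<in> S"
  shows "layer_proj \<alpha> x \<in> S"
  by (rule layer_proj_stable_aux[where W = "weight ` E"])
    (auto simp: assms finite_E layer_proj_outside)

definition eigenvectors :: "'a set"
  where "eigenvectors = (\<Union>\<alpha>\<in>weight ` E. torus_layer F \<alpha>)"

lemma eigenvectors_span:
  assumes "subspace S" and "\<And>D x. D \<in> F \<Longrightarrow> x \<in> S \<Longrightarrow> D x \<in> S" and "x \<in> S"
  shows "x \<in> span (S \<inter> eigenvectors)"
proof -
  have "(\<Sum>\<alpha>\<in>weight ` E. layer_proj \<alpha> x) \<in> span (S \<inter> eigenvectors)"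
    using layer_proj_in layer_proj_stable[where S = S and x = x] assms
    by (intro span_sum span_base) (auto simp: eigenvectors_def)
  then show ?thesis by (simp add: sum_layer_proj)
qed

text \<open>A subspace stable under \<open>F\<close> is spanned by the common eigenvectors in it, so
  \<open>C\<close> can be completed by eigenvectors alone. This is used with \<open>S\<close> the
  center and \<open>C\<close> a basis of the derived algebra, once for a torus and once for a single
  idempotent.\<close>

lemma eigen_basis_extension:
  assumes "subspace S" and "\<And>D x. D \<in> F \<Longrightarrow> x \<in> S \<Longrightarrow> D x \<in> S" and "independent C"
  obtains B where "B \<subseteq> S \<inter> eigenvectors" "C \<inter> B = {}" "independent (C \<union> B)"
    "span (C \<union> B) = span (C \<union> S)"
proof -
  obtain G where G: "C \<subseteq> G" "G \<subseteq> C \<union> (S \<inter> eigenvectors)" "independent G"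
    "C \<union> (S \<inter> eigenvectors) \<subseteq> span G"
    by (rule maximal_independent_subset_extend[OF _ assms(3), of "C \<union> (S \<inter> eigenvectors)"]) auto
  have "C \<union> (G - C) = G" using G by auto
  moreover have "S \<subseteq> span G"
    using eigenvectors_span[where S = S] assms(1,2) span_minimal[of "S \<inter> eigenvectors" "span G"] G by blast
  then have "span G = span (C \<union> S)"
    using G by (auto simp: span_eq intro: span_base)
  ultimately show thesis
    using G that[of "G - C"] by auto
qed

end

section \<open>Conjugating idempotents of the centroid\<close>

context fd_lie_algebra
begin

definition center :: "'a set"
  where "center = {z. \<forall>x. bracket z x = 0}"

definition derived :: "'a set"
  where "derived = span {bracket x y | x y. True}"

definition centroid :: "('a \<Rightarrow> 'a) set"
  where "centroid = {c. lin c \<and> (\<forall>x y. c (bracket x y) = bracket (c x) y)}"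

definition inverse_automorphisms :: "('a \<Rightarrow> 'a) \<Rightarrow> ('a \<Rightarrow> 'a) \<Rightarrow> bool"
  where "inverse_automorphisms \<Phi> \<Phi>' \<longleftrightarrow> lin \<Phi> \<and> lin \<Phi>' \<and> (\<forall>x. \<Phi> (\<Phi>' x) = x) \<and> (\<forall>x. \<Phi>' (\<Phi> x) = x) \<and>
    (\<forall>x y. \<Phi> (bracket x y) = bracket (\<Phi> x) (\<Phi> y))"

lemma subspace_center: "subspace center"
  by (rule subspaceI) (auto simp: center_def bracket_add_left bracket_scale_left)

lemma bracket_center: "z \<in> center \<Longrightarrow> bracket z x = 0" "z \<in> center \<Longrightarrow> bracket x z = 0"
  using bracket_antisym[of z x] by (auto simp: center_def)

lemma bracket_derived: "bracket x y \<in> derived"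
  unfolding derived_def by (rule span_base) auto

lemma eq_0_on_derived:
  assumes "lin f" "\<And>x y. f (bracket x y) = 0" "v \<in> derived" shows "f v = 0"
  by (rule endo.linear_eq_0_on_span[OF assms(1), where b = "{bracket x y | x y. True}"])
    (use assms(2,3) in \<open>auto simp: derived_def\<close>)

lemma centroidD:
  assumes "c \<in> centroid"
  shows "lin c" "c (bracket x y) = bracket (c x) y" "c (bracket x y) = bracket x (c y)"
proof -
  show "lin c" and *: "c (bracket x y) = bracket (c x) y" for x y
    using assms by (auto simp: centroid_def)
  then show "c (bracket x y) = bracket x (c y)"
    by (metis bracket_antisym lin_simps(4))
qed

lemma centroid_center: "c \<in> centroid \<Longrightarrow> z \<in> center \<Longrightarrow> c z \<in> center"
  using centroidD(2)[of c z] lin_simps(5)[OF centroidD(1)[of c]] by (simp add: center_def flip: centroidD(2))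

lemma derivationD:
  assumes "D \<in> derivations"
  shows "lin D" "D (bracket x y) = bracket (D x) y + bracket x (D y)"
  using assms by (auto simp: derivations_def)

lemma derivation_center:
  assumes "D \<in> derivations" "z \<in> center" shows "D z \<in> center"
proof -
  have "bracket (D z) x = 0" for x
    using derivationD(2)[OF assms(1), of z x] bracket_center[OF assms(2)]
      lin_simps(5)[OF derivationD(1)[OF assms(1)]] by simp
  then show ?thesis by (simp add: center_def)
qed

text \<open>Brackets do not see a change by central elements, so a linear bijection that is the
  identity modulo the center and fixes all brackets preserves the bracket. Both automorphisms
  constructed below are of this kind.\<close>

lemma central_automorphismI:
  assumes "lin \<Phi>" "lin \<Phi>'" "\<And>x. \<Phi> (\<Phi>' x) = x" "\<And>x. \<Phi>' (\<Phi> x) = x"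
    and central: "\<And>x. \<Phi> x - x \<in> center" and fixed: "\<And>x y. \<Phi> (bracket x y) = bracket x y"
  shows "inverse_automorphisms \<Phi> \<Phi>'"
proof -
  have "bracket (\<Phi> x) (\<Phi> y) = bracket x y" for x y
  proof -
    have "bracket (\<Phi> x) (\<Phi> y) = bracket (x + (\<Phi> x - x)) (y + (\<Phi> y - y))" by simp
    also have "\<dots> = bracket x y"
      by (simp only: bracket_add_left bracket_add_right bracket_center central add_0_right)
    finally show ?thesis .
  qed
  then show ?thesis
    unfolding inverse_automorphisms_def by (simp add: assms)
qed

lemma inverse_automorphisms_compose:
  assumes "inverse_automorphisms \<Phi> \<Phi>'" "inverse_automorphisms \<Psi> \<Psi>'"
  shows "inverse_automorphisms (\<lambda>x. \<Phi> (\<Psi> x)) (\<lambda>x. \<Psi>' (\<Phi>' x))"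
  using assms unfolding inverse_automorphisms_def
  by (auto intro!: linI simp: lin_simps)

lemma centroid_conjugate:
  assumes "inverse_automorphisms \<Phi> \<Phi>'" "e \<in> centroid"
  shows "(\<lambda>x. \<Phi> (e (\<Phi>' x))) \<in> centroid"
proof -
  have inv: "\<Phi>' (bracket x y) = bracket (\<Phi>' x) (\<Phi>' y)" for x y
    using assms(1) unfolding inverse_automorphisms_def by metis
  show ?thesis
    using assms inv centroidD(1,2)[OF assms(2)] unfolding centroid_def inverse_automorphisms_def
    by (auto intro!: linI simp: lin_simps)
qed

text \<open>The splitting \<open>x = e x + (x - e x)\<close> diagonalizes an idempotent with
  eigenvalues 1 and 0. The locale \<open>diag_family\<close> asks only for linear maps so that it
  covers this case as well as tori.\<close>

lemma idempotent_diag_family: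
  assumes e: "lin e" "\<And>x. e (e x) = e x"
  obtains E where "diag_family scale bracket Basis {e} E"
proof -
  let ?S = "{x. e x = x} \<union> {x. e x = 0}"
  obtain E where E: "E \<subseteq> ?S" "independent E" "?S \<subseteq> span E"
    by (rule maximal_independent_subset)
  have "x \<in> span E" for x
  proof -
    have "e x \<in> span E" "x - e x \<in> span E"
      using e E(3) by (auto simp: lin_simps)
    then show ?thesis using span_add[of "e x" E "x - e x"] by simp
  qed
  then have span: "span E = UNIV" by blast
  have eigen: "\<exists>c. e b = scale c b" if "b \<in> E" for b
  proof -
    from E(1) that consider "e b = scale 1 b" | "e b = scale 0 b" by auto
    then show ?thesis by cases blast+
  qed
  have "diag_family scale bracket Basis {e} E"
  proof (rule diag_family.intro[OF fd_lie_algebra_axioms], rule diag_family_axioms.intro)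
    show "lin D" if "D \<in> {e}" for D using that e(1) by simp
    show "independent E" by (rule E(2))
    show "span E = UNIV" by (rule span)
    show "\<exists>c. D b = scale c b" if "b \<in> E" "D \<in> {e}" for b D using that eigen by simp
  qed
  then show thesis by (rule that)
qed

end

locale torus_family = diag_family scale bracket Basis T E
  for scale :: "'k::field_char_0 \<Rightarrow> 'a::ab_group_add \<Rightarrow> 'a"
    and bracket :: "'a \<Rightarrow> 'a \<Rightarrow> 'a" and Basis :: "'a set" and T E +
  assumes T_derivations: "T \<subseteq> derivations"
begin

lemma torus_deriv: "D \<in> T \<Longrightarrow> D (bracket x y) = bracket (D x) y + bracket x (D y)"
  using T_derivations derivationD by auto

text \<open>Inside the sum of the derived algebra and the center, the derived algebra has two
  complements: one with a basis \<open>B\<close> of central eigenvectors of \<open>T\<close>, the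
  other with a basis \<open>B'\<close> of central eigenvectors of \<open>e\<close>. They have equal
  dimension. The map \<Theta> carries \<open>B'\<close> to \<open>B\<close> and fixes a common
  complement containing the derived algebra, so it moves vectors by central elements only and makes
  \<open>B\<close> consist of eigenvectors of the conjugate of \<open>e\<close>.\<close>

lemma align_idempotent:
  assumes e: "e \<in> centroid" "\<And>x. e (e x) = e x"
  obtains \<Theta> \<Theta>' B where "inverse_automorphisms \<Theta> \<Theta>'"
    "B \<subseteq> eigenvectors" "center \<subseteq> span (derived \<union> B)"
    "\<And>b. b \<in> B \<Longrightarrow> \<exists>c. \<Theta> (e (\<Theta>' b)) = scale c b"
proof -
  obtain Ee where "diag_family scale bracket Basis {e} Ee"
    using idempotent_diag_family e centroidD(1) by blast
  then interpret ev: diag_family scale bracket Basis "{e}" Ee .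
  obtain B\<^sub>1 where B\<^sub>1: "B\<^sub>1 \<subseteq> derived" "independent B\<^sub>1" "derived \<subseteq> span B\<^sub>1"
    by (rule maximal_independent_subset)
  obtain B where B: "B \<subseteq> center \<inter> eigenvectors" "B\<^sub>1 \<inter> B = {}" "independent (B\<^sub>1 \<union> B)"
    "span (B\<^sub>1 \<union> B) = span (B\<^sub>1 \<union> center)"
    using eigen_basis_extension[OF subspace_center _ B\<^sub>1(2)] derivation_center T_derivations by blast
  obtain B' where B': "B' \<subseteq> center \<inter> ev.eigenvectors" "B\<^sub>1 \<inter> B' = {}" "independent (B\<^sub>1 \<union> B')"
    "span (B\<^sub>1 \<union> B') = span (B\<^sub>1 \<union> center)"
    using ev.eigen_basis_extension[OF subspace_center _ B\<^sub>1(2)] centroid_center e(1) by blast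
  have fin: "finite B\<^sub>1" "finite B" "finite B'"
    using finiteI_independent[OF B(3)] finiteI_independent[OF B'(3)] by auto
  have "card (B\<^sub>1 \<union> B) = card (B\<^sub>1 \<union> B')"
    by (metis B(3,4) B'(3,4) dim_span_eq_card_independent)
  then have card_eq: "card B' = card B"
    using B(2) B'(2) fin by (simp add: card_Un_disjoint)
  then obtain \<phi> where \<phi>: "bij_betw \<phi> B' B"
    using finite_same_card_bij[OF fin(3,2) card_eq] by blast
  obtain G where "B\<^sub>1 \<union> B \<subseteq> G" "G \<subseteq> UNIV" "independent G" "UNIV \<subseteq> span G"
    by (rule maximal_independent_subset_extend[OF subset_UNIV B(3)])
  then have G: "B\<^sub>1 \<union> B \<subseteq> G" "independent G" "span G = UNIV" by auto
  \<comment> \<open>\<open>C\<close> contains the basis \<open>B\<^sub>1\<close> of the derived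
    algebra, modulo which \<open>B\<close> and \<open>B'\<close> span the same space; hence
    replacing \<open>B\<close> by \<open>B'\<close> in the basis \<open>G\<close> leaves a spanning
    set.\<close>
  define C where "C = G - B"
  have C: "B\<^sub>1 \<subseteq> C" "C \<inter> B = {}" "C \<union> B = G" "finite C"
    using G B(2) finiteI_independent[OF G(2)] by (auto simp: C_def)
  have "B \<subseteq> span (C \<union> B')"
  proof -
    have "B \<subseteq> span (B\<^sub>1 \<union> B')" using B(4) B'(4) span_superset[of "B\<^sub>1 \<union> B"] by auto
    also have "\<dots> \<subseteq> span (C \<union> B')" using C by (intro span_mono) auto
    finally show ?thesis .
  qed
  then have "span G \<subseteq> span (C \<union> B')"
    using C span_base[of _ "C \<union> B'"] by (intro span_minimal) auto
  then have span': "span (C \<union> B') = UNIV" using G by auto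
  have cardG: "card G = dimension"
    using dim_eq_card_independent[OF G(2)] dim_span[of G] G(3) by (simp add: dimension_def)
  have cardG': "card G = card C + card B'"
    using C fin card_eq by (metis card_Un_disjoint)
  \<comment> \<open>A spanning set has at least \<open>dimension\<close> elements, while the sizes
    of \<open>C\<close> and \<open>B'\<close> add up to exactly that number. So the two sets are
    disjoint and their union is a basis.\<close>
  have ge: "card (C \<union> B') \<ge> dimension"
    using dim_le_card[of UNIV "C \<union> B'"] span' C fin by (simp add: dimension_def)
  have sum: "card C + card B' = card (C \<union> B') + card (C \<inter> B')"
    using C fin by (intro card_Un_Int) auto
  have "card (C \<inter> B') = 0"
    using ge sum cardG cardG' by linarith
  then have "C \<inter> B' = {}"
    using C by simp
  have indep': "independent (C \<union> B')"
    using card_le_dim_spanning[of "C \<union> B'" UNIV] span' C fin sum cardG cardG' by (simp add: dimension_def)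
  obtain \<Theta> where \<Theta>: "lin \<Theta>" "\<forall>x\<in>C \<union> B'. \<Theta> x = (if x \<in> B' then \<phi> x else x)"
    using endo.linear_independent_extend[OF indep', of "\<lambda>x. if x \<in> B' then \<phi> x else x"] by blast
  obtain \<Theta>' where \<Theta>': "lin \<Theta>'" "\<forall>x\<in>G. \<Theta>' x = (if x \<in> B then inv_into B' \<phi> x else x)"
    using endo.linear_independent_extend[OF G(2), of "\<lambda>x. if x \<in> B then inv_into B' \<phi> x else x"] by blast
  have \<Theta>_C: "\<Theta> x = x" if "x \<in> C" for x
    using that \<Theta>(2) \<open>C \<inter> B' = {}\<close> by auto
  have \<Theta>_B': "\<Theta> x = \<phi> x" if "x \<in> B'" for x
    using that \<Theta>(2) by auto
  have \<Theta>'_C: "\<Theta>' x = x" if "x \<in> C" for x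
    using that \<Theta>'(2) C by auto
  have \<Theta>'_B: "\<Theta>' x = inv_into B' \<phi> x" if "x \<in> B" for x
    using that \<Theta>'(2) C by auto
  have lin_id: "lin (\<lambda>x. x)" by (rule linI) simp_all
  have left: "\<Theta>' (\<Theta> x) = x" for x
  proof (rule endo.linear_eq_on_span[where f = "\<lambda>x. \<Theta>' (\<Theta> x)" and B = "C \<union> B'"])
    show "lin (\<lambda>x. \<Theta>' (\<Theta> x))" using \<Theta>(1) \<Theta>'(1) by (intro linI) (simp_all add: lin_simps)
    show "\<Theta>' (\<Theta> x) = x" if "x \<in> C \<union> B'" for x
      using that \<phi> by (auto simp: \<Theta>_C \<Theta>_B' \<Theta>'_C \<Theta>'_B bij_betwE bij_betw_inv_into_left)
  qed (simp_all add: lin_id span')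
  have right: "\<Theta> (\<Theta>' x) = x" for x
  proof (rule endo.linear_eq_on_span[where f = "\<lambda>x. \<Theta> (\<Theta>' x)" and B = "C \<union> B"])
    show "lin (\<lambda>x. \<Theta> (\<Theta>' x))" using \<Theta>(1) \<Theta>'(1) by (intro linI) (simp_all add: lin_simps)
    show "\<Theta> (\<Theta>' x) = x" if "x \<in> C \<union> B" for x
      using that bij_betw_inv_into_right[OF \<phi>] bij_betwE[OF bij_betw_inv_into[OF \<phi>]]
      by (auto simp: \<Theta>_C \<Theta>_B' \<Theta>'_C \<Theta>'_B)
  qed (simp_all add: lin_id C G)
  have central: "\<Theta> x - x \<in> center" for x
  proof -
    have "subspace {x. \<Theta> x - x \<in> center}"
      using \<Theta>(1) by (intro endo.linear_subspace_linear_preimage subspace_center linI)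
        (simp_all add: lin_simps scale_right_diff_distrib)
    moreover have "\<Theta> x - x \<in> center" if "x \<in> C \<union> B'" for x
    proof (cases "x \<in> C")
      case True
      then show ?thesis by (simp add: \<Theta>_C subspace_0[OF subspace_center])
    next
      case False
      with that have "x \<in> B'" by simp
      then show ?thesis
        using B(1) B'(1) bij_betwE[OF \<phi>]
        by (auto simp: \<Theta>_B' intro!: subspace_diff[OF subspace_center])
    qed
    ultimately have "span (C \<union> B') \<subseteq> {x. \<Theta> x - x \<in> center}"
      by (intro span_minimal) auto
    then show ?thesis using span' by auto
  qed
  have fixed: "\<Theta> (bracket x y) = bracket x y" for x y
    by (rule endo.linear_eq_on_span[where f = \<Theta> and B = B\<^sub>1])
      (use \<Theta>(1) lin_id \<Theta>_C C B\<^sub>1 bracket_derived in auto)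
  show thesis
  proof
    show "inverse_automorphisms \<Theta> \<Theta>'"
      by (rule central_automorphismI) (fact \<Theta>(1) \<Theta>'(1) left right central fixed)+
    show "B \<subseteq> eigenvectors" using B by auto
    show "center \<subseteq> span (derived \<union> B)"
    proof -
      have "center \<subseteq> span (B\<^sub>1 \<union> B)" using B(4) span_superset[of "B\<^sub>1 \<union> center"] by auto
      also have "\<dots> \<subseteq> span (derived \<union> B)" using B\<^sub>1 by (intro span_mono) auto
      finally show ?thesis .
    qed
    show "\<exists>c. \<Theta> (e (\<Theta>' b)) = scale c b" if "b \<in> B" for b
    proof -
      define b' where "b' = inv_into B' \<phi> b"
      have b': "b' \<in> B'" "\<phi> b' = b"
        using that bij_betw_inv_into_right[OF \<phi>] bij_betwE[OF bij_betw_inv_into[OF \<phi>]]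
        by (auto simp: b'_def)
      then have "b' \<in> ev.eigenvectors" using B' by auto
      then obtain c where "e b' = scale c b'"
        by (auto simp: ev.eigenvectors_def torus_layer_def)
      then have "\<Theta> (e (\<Theta>' b)) = scale c b"
        using that b' \<Theta>(1) by (simp add: \<Theta>'_B \<Theta>_B' lin_simps flip: b'_def)
      then show ?thesis ..
    qed
  qed
qed

section \<open>Weights of brackets, and the weight zero part of a centroid element\<close>

lemma mult_dual: "\<alpha> \<otimes>\<^bsub>dual_group T\<^esub> \<beta> = (\<lambda>D\<in>T. \<alpha> D + \<beta> D)"
  by (simp add: dual_group_def)

lemma bracket_layers:
  assumes "x \<in> torus_layer T \<alpha>" "y \<in> torus_layer T \<beta>"
  shows "bracket x y \<in> torus_layer T (\<alpha> \<otimes>\<^bsub>dual_group T\<^esub> \<beta>)"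
proof -
  have "D (bracket x y) = scale ((\<alpha> \<otimes>\<^bsub>dual_group T\<^esub> \<beta>) D) (bracket x y)" if "D \<in> T" for D
  proof -
    have "D x = scale (\<alpha> D) x" "D y = scale (\<beta> D) y"
      using assms that by (auto simp: torus_layer_def)
    then show ?thesis
      using that by (simp add: mult_dual torus_deriv bracket_scale_left bracket_scale_right
          scale_left_distrib)
  qed
  then show ?thesis by (simp add: torus_layer_def)
qed

lemma weight_image_extensional: "\<alpha> \<in> weight ` E \<Longrightarrow> \<alpha> \<in> extensional T"
  using weight_extensional by auto

lemma mult_dual_extensional: "\<alpha> \<otimes>\<^bsub>dual_group T\<^esub> \<beta> \<in> extensional T"
  by (simp add: mult_dual)

lemma mult_dual_cancel:
  assumes "\<alpha> \<in> extensional T" "\<gamma> \<in> extensional T"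
    "\<alpha> \<otimes>\<^bsub>dual_group T\<^esub> \<beta> = \<gamma> \<otimes>\<^bsub>dual_group T\<^esub> \<beta>"
  shows "\<alpha> = \<gamma>"
proof (rule extensionalityI[OF assms(1,2)])
  show "\<alpha> D = \<gamma> D" if "D \<in> T" for D
    using fun_cong[OF assms(3), of D] that by (simp add: mult_dual)
qed

text \<open>Bracketing with \<open>y\<close> shifts all weights by \<beta>, and the shift is
  injective, so only the component of \<open>u\<close> at \<alpha> can contribute to the shifted
  weight of \<alpha>.\<close>

lemma layer_proj_bracket:
  assumes "y \<in> torus_layer T \<beta>" "\<alpha> \<in> extensional T"
  shows "layer_proj (\<alpha> \<otimes>\<^bsub>dual_group T\<^esub> \<beta>) (bracket u y) = bracket (layer_proj \<alpha> u) y"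
proof -
  let ?P = "layer_proj (\<alpha> \<otimes>\<^bsub>dual_group T\<^esub> \<beta>)"
  have P: "?P (bracket (layer_proj \<delta> u) y) = (if \<delta> = \<alpha> then bracket (layer_proj \<alpha> u) y else 0)"
    if "\<delta> \<in> extensional T" for \<delta>
    using bracket_layers[OF layer_proj_in assms(1), of \<delta> u] mult_dual_cancel[OF assms(2) that]
    by (auto intro: layer_proj_id layer_proj_other mult_dual_extensional)
  have "?P (bracket u y) = ?P (bracket (\<Sum>\<delta>\<in>weight ` E. layer_proj \<delta> u) y)"
    by (simp only: sum_layer_proj)
  also have "\<dots> = (\<Sum>\<delta>\<in>weight ` E. ?P (bracket (layer_proj \<delta> u) y))"
    by (simp only: bracket_sum_left lin_simps[OF lin_layer_proj])
  also have "\<dots> = (\<Sum>\<delta>\<in>weight ` E. if \<delta> = \<alpha> then bracket (layer_proj \<alpha> u) y else 0)"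
    by (intro sum.cong refl P weight_image_extensional)
  also have "\<dots> = bracket (layer_proj \<alpha> u) y"
    using layer_proj_outside[of \<alpha> u] by (simp add: sum.delta' finite_E)
  finally show ?thesis .
qed

text \<open>For the action of \<open>T\<close> on endomorphisms by commutators this is the component
  of weight zero: the diagonal blocks of \<open>e\<close> with respect to the layers.\<close>

definition weight_zero_part :: "('a \<Rightarrow> 'a) \<Rightarrow> 'a \<Rightarrow> 'a"
  where "weight_zero_part e x = (\<Sum>\<alpha>\<in>weight ` E. layer_proj \<alpha> (e (layer_proj \<alpha> x)))"

context
  fixes e assumes lin_e: "lin e"
begin

lemma lin_weight_zero_part: "lin (weight_zero_part e)"
  unfolding weight_zero_part_def
  by (rule linI) (simp_all add: lin_simps[OF lin_e] lin_simps[OF lin_layer_proj] sum.distrib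
      scale_sum_right)

lemma weight_zero_part_commute:
  "D \<in> T \<Longrightarrow> D (weight_zero_part e x) = weight_zero_part e (D x)"
  unfolding weight_zero_part_def
  by (simp add: lin_simps[OF lin_F] lin_simps[OF lin_e] lin_simps[OF lin_layer_proj]
      layer_proj_apply apply_layer_proj)

lemma weight_zero_part_layer:
  assumes "x \<in> torus_layer T \<alpha>" "\<alpha> \<in> extensional T"
  shows "weight_zero_part e x = layer_proj \<alpha> (e x)"
proof -
  have "weight_zero_part e x = (\<Sum>\<beta>\<in>weight ` E. if \<beta> = \<alpha> then layer_proj \<alpha> (e x) else 0)"
    unfolding weight_zero_part_def
    by (rule sum.cong) (auto simp: layer_proj_id[OF assms] layer_proj_other[OF assms]
        lin_simps[OF lin_e] lin_simps[OF lin_layer_proj])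
  then show ?thesis
    using layer_proj_outside[of \<alpha> "e x"] by (simp add: sum.delta' finite_E)
qed

end

text \<open>A centroid element moves out of a bracket, and by \<open>layer_proj_bracket\<close>
  taking the diagonal block on a bracket amounts to taking it on the first entry. By bilinearity it
  is enough to compare on layers.\<close>

lemma weight_zero_part_centroid:
  assumes "e \<in> centroid" shows "weight_zero_part e \<in> centroid"
proof -
  note lin_e = centroidD(1)[OF assms]
  let ?e = "weight_zero_part e"
  note lin0 = lin_weight_zero_part[OF lin_e]
  have layers: "?e (bracket x y) = bracket (?e x) y"
    if "x \<in> torus_layer T \<alpha>" "\<alpha> \<in> extensional T" "y \<in> torus_layer T \<beta>" for x y \<alpha> \<beta>
    using weight_zero_part_layer[OF lin_e bracket_layers[OF that(1,3)] mult_dual_extensional]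
      weight_zero_part_layer[OF lin_e that(1,2)] layer_proj_bracket[OF that(3,2)]
    by (simp add: centroidD(2)[OF assms])
  have "?e (bracket x y) = bracket (?e x) y" for x y
  proof -
    have "?e (bracket (\<Sum>\<alpha>\<in>weight ` E. layer_proj \<alpha> x) (\<Sum>\<beta>\<in>weight ` E. layer_proj \<beta> y))
        = bracket (?e (\<Sum>\<alpha>\<in>weight ` E. layer_proj \<alpha> x)) (\<Sum>\<beta>\<in>weight ` E. layer_proj \<beta> y)"
      unfolding bracket_sum_left bracket_sum_right lin_simps(6)[OF lin0]
      by (intro sum.cong refl layers[OF layer_proj_in weight_image_extensional layer_proj_in])
    then show ?thesis by (simp only: sum_layer_proj)
  qed
  then show ?thesis using lin0 by (simp add: centroid_def)
qed

text \<open>Applying the derivation \<open>[D,\<cdot>]\<close> to \<open>e\<^sup>2 = e\<close> inside the centroid, whose elements commute on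
  the derived algebra, gives \<open>2 e [D,e] = [D,e]\<close> there, hence \<open>[D,e] = 0\<close> there.\<close>

lemma commutator_idempotent:
  assumes e: "e \<in> centroid" "\<And>x. e (e x) = e x" and D: "D \<in> T"
  shows "D (e x) - e (D x) \<in> center"
proof -
  define f where "f x = D (e x) - e (D x)" for x
  note lin_e = lin_simps[OF centroidD(1)[OF e(1)]] and lin_D = lin_simps[OF lin_F[OF D]]
  have f1: "f (bracket x y) = bracket (f x) y" for x y
    by (simp add: f_def torus_deriv[OF D] centroidD(2)[OF e(1)] lin_e bracket_diff_left)
  have f2: "f (bracket x y) = bracket x (f y)" for x y
    by (simp add: f_def torus_deriv[OF D] centroidD(3)[OF e(1)] lin_e bracket_diff_right)
  have sum: "f (e x) + e (f x) = f x" for x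
    by (simp add: f_def e lin_e)
  have "f (bracket x y) = 0" for x y
  proof -
    let ?v = "bracket x y"
    have "f (e ?v) = e (f ?v)"
      by (simp add: centroidD(2)[OF e(1)] f2)
    then have *: "f ?v = e (f ?v) + e (f ?v)" using sum[of ?v] by simp
    then have "e (f ?v) = e (e (f ?v) + e (f ?v))" by simp
    then have "e (f ?v) = 0" by (simp add: lin_e e)
    then show ?thesis using * by simp
  qed
  then have "f x \<in> center" by (simp add: center_def flip: f1)
  then show ?thesis by (simp add: f_def)
qed

text \<open>The block of \<open>e\<close> from the layer at \<alpha> to the layer at \<gamma>,
  multiplied by \<open>\<gamma> D - \<alpha> D\<close>, is a block of the commutator of
  \<open>D\<close> and \<open>e\<close>, which has central values. Components of central elements
  are central because derivations preserve the center.\<close>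

lemma weight_zero_part_diff_central:
  assumes e: "e \<in> centroid" "\<And>x. e (e x) = e x"
  shows "weight_zero_part e x - e x \<in> center"
proof -
  note lin_e = lin_simps[OF centroidD(1)[OF e(1)]]
  have off_diagonal: "layer_proj \<gamma> (e y) \<in> center"
    if y: "y \<in> torus_layer T \<alpha>" "\<alpha> \<in> extensional T" "\<gamma> \<in> extensional T" "\<gamma> \<noteq> \<alpha>" for y \<alpha> \<gamma>
  proof -
    obtain D where D: "D \<in> T" "\<gamma> D \<noteq> \<alpha> D"
      using y extensionalityI[of \<gamma> T \<alpha>] by blast
    have "D y = scale (\<alpha> D) y" using y D by (simp add: torus_layer_def)
    then have "layer_proj \<gamma> (D (e y) - e (D y)) = scale (\<gamma> D - \<alpha> D) (layer_proj \<gamma> (e y))"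
      using D by (simp add: lin_simps[OF lin_layer_proj] lin_e layer_proj_apply scale_left_diff_distrib)
    moreover have "layer_proj \<gamma> (D (e y) - e (D y)) \<in> center"
      by (rule layer_proj_stable[OF subspace_center])
        (use T_derivations derivation_center commutator_idempotent[OF e] D in auto)
    ultimately have "scale (\<gamma> D - \<alpha> D) (layer_proj \<gamma> (e y)) \<in> center" by simp
    then have "scale (inverse (\<gamma> D - \<alpha> D)) (scale (\<gamma> D - \<alpha> D) (layer_proj \<gamma> (e y))) \<in> center"
      by (rule subspace_scale[OF subspace_center])
    then show ?thesis using D by simp
  qed
  have "e y - layer_proj \<alpha> (e y) \<in> center"
    if "y \<in> torus_layer T \<alpha>" "\<alpha> \<in> weight ` E" for y \<alpha>
  proof -
    have "e y = layer_proj \<alpha> (e y) + (\<Sum>\<gamma>\<in>weight ` E - {\<alpha>}. layer_proj \<gamma> (e y))"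
      using sum_layer_proj[of "e y"] sum.remove[of "weight ` E" \<alpha>] that finite_E
      by (metis finite_imageI)
    then have "e y - layer_proj \<alpha> (e y) = (\<Sum>\<gamma>\<in>weight ` E - {\<alpha>}. layer_proj \<gamma> (e y))"
      by (simp add: diff_eq_eq add.commute)
    also have "\<dots> \<in> center"
      using off_diagonal[OF that(1)] weight_image_extensional that
      by (intro subspace_sum[OF subspace_center]) auto
    finally show ?thesis .
  qed
  then have "(\<Sum>\<alpha>\<in>weight ` E. e (layer_proj \<alpha> x) - layer_proj \<alpha> (e (layer_proj \<alpha> x))) \<in> center"
    using layer_proj_in by (intro subspace_sum[OF subspace_center]) blast
  then have "e x - weight_zero_part e x \<in> center"
    by (simp add: sum_subtractf weight_zero_part_def flip: lin_e(6)) (simp add: sum_layer_proj)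
  then show ?thesis
    using subspace_neg[OF subspace_center] by fastforce
qed

text \<open>The error \<open>k\<close> is an element of the centroid with central values, so it
  kills brackets. It kills \<open>B\<close> as well, because \<open>e\<close> acts by a scalar on
  each vector of \<open>B\<close> and that vector lies in one layer. So it kills the whole center,
  which contains its own values.\<close>

lemma conjugate_aligned_idempotent:
  assumes e: "e \<in> centroid" "\<And>x. e (e x) = e x"
    and B: "B \<subseteq> eigenvectors" "center \<subseteq> span (derived \<union> B)" "\<And>b. b \<in> B \<Longrightarrow> \<exists>c. e b = scale c b"
  obtains \<Phi> \<Phi>' where "inverse_automorphisms \<Phi> \<Phi>'"
    "\<And>D x. D \<in> T \<Longrightarrow> D (\<Phi> (e (\<Phi>' x))) = \<Phi> (e (\<Phi>' (D x)))"
proof -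
  define e\<^sub>0 where "e\<^sub>0 = weight_zero_part e"
  define k where "k x = e\<^sub>0 x - e x" for x
  have cent: "e\<^sub>0 \<in> centroid" using weight_zero_part_centroid[OF e(1)] by (simp add: e\<^sub>0_def)
  note lin_e = lin_simps[OF centroidD(1)[OF e(1)]] and lin_e0 = lin_simps[OF centroidD(1)[OF cent]]
  have lin_k': "lin k"
    by (rule linI) (simp_all add: k_def lin_e lin_e0 scale_right_diff_distrib)
  note lin_k = lin_simps[OF this]
  have k_center: "k x \<in> center" for x
    using weight_zero_part_diff_central[OF e] by (simp add: k_def e\<^sub>0_def)
  have k_bracket: "k (bracket x y) = 0" for x y
    using bracket_center(1)[OF k_center, of x y]
    by (simp add: k_def centroidD(2)[OF e(1)] centroidD(2)[OF cent] bracket_diff_left)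
  have k_B: "k b = 0" if b: "b \<in> B" for b
  proof -
    obtain \<alpha> where \<alpha>: "b \<in> torus_layer T \<alpha>" "\<alpha> \<in> extensional T"
      using b B(1) weight_extensional by (auto simp: eigenvectors_def)
    obtain c where "e b = scale c b" using B(3) b by blast
    then show ?thesis
      using weight_zero_part_layer[OF centroidD(1)[OF e(1)] \<alpha>] layer_proj_id[OF \<alpha>]
      by (simp add: k_def e\<^sub>0_def lin_simps[OF lin_layer_proj])
  qed
  have k_0: "k z = 0" if "z \<in> center" for z
    by (rule endo.linear_eq_0_on_span[OF lin_k', where b = "derived \<union> B"])
      (use that B(2) k_B eq_0_on_derived[OF lin_k' k_bracket] in auto)
  \<comment> \<open>Conjugation by \<open>1 + n\<close>, whose inverse is \<open>1 - n\<close>, adds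
    to \<open>e\<close> the term \<open>n e - e n = k e + e k - 2 e k e\<close>, the off-diagonal
    part of \<open>k\<close> with respect to \<open>e\<close>. Since \<open>k k\<close> and
    \<open>k e k\<close> vanish, the polynomial below evaluated at \<open>e + k\<close> adds the
    same term.\<close>
  define n where "n x = k (e x) - e (k x)" for x
  have lin_n': "lin n"
    by (rule linI) (simp_all add: n_def lin_e lin_k scale_right_diff_distrib)
  note lin_n = lin_simps[OF this]
  have n_center: "n x \<in> center" for x
    unfolding n_def
    using k_center centroid_center[OF e(1)] by (intro subspace_diff[OF subspace_center]) auto
  have n_0: "n z = 0" if "z \<in> center" for z
    using that by (simp add: n_def k_0 centroid_center[OF e(1)] lin_e)
  have n_bracket: "n (bracket x y) = 0" for x y
    by (simp add: n_def k_bracket lin_e) (simp add: centroidD(2)[OF e(1)] k_bracket)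
  have aut: "inverse_automorphisms (\<lambda>x. x + n x) (\<lambda>x. x - n x)"
    by (rule central_automorphismI)
      (auto intro!: linI simp: lin_n n_0 n_center n_bracket scale_right_distrib
        scale_right_diff_distrib)
  text \<open>The polynomial \<open>3 t\<^sup>2 - 2 t\<^sup>3\<close> lifts the idempotent \<open>e\<^sub>0\<close> modulo the square-zero ideal
    containing \<open>k\<close>.\<close>
  have conj: "(e (x - n x)) + n (e (x - n x)) =
      e\<^sub>0 (e\<^sub>0 x) + e\<^sub>0 (e\<^sub>0 x) + e\<^sub>0 (e\<^sub>0 x) - e\<^sub>0 (e\<^sub>0 (e\<^sub>0 x)) - e\<^sub>0 (e\<^sub>0 (e\<^sub>0 x))" for x
  proof -
    have e0: "e\<^sub>0 x = e x + k x" for x by (simp add: k_def)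
    have ek: "k (k x) = 0" "k (e (k x)) = 0" for x
      using k_0 k_center centroid_center[OF e(1)] by auto
    have "n (e (n x)) = 0" using n_0 n_center centroid_center[OF e(1)] by blast
    then show ?thesis
      by (simp add: lin_e lin_n e0 lin_k ek e) (simp add: n_def lin_e e)
  qed
  \<comment> \<open>The weight zero part commutes with \<open>T\<close>, hence so does every
    polynomial in it.\<close>
  have "D (e (x - n x) + n (e (x - n x))) = e (D x - n (D x)) + n (e (D x - n (D x)))"
    if "D \<in> T" for D x
    unfolding conj using that weight_zero_part_commute[OF centroidD(1)[OF e(1)]]
    by (simp add: lin_simps[OF lin_F] e\<^sub>0_def)
  with aut show thesis by (rule that)
qed

text \<open>Conjugation by \<Theta> supplies the eigenvectors \<open>B\<close> that the lifting
  argument asks for; the second conjugation \<Psi> then makes the idempotent commute with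
  \<open>T\<close>.\<close>

lemma conjugate_idempotent:
  assumes e: "e \<in> centroid" "\<And>x. e (e x) = e x"
  obtains \<Phi> \<Phi>' where "inverse_automorphisms \<Phi> \<Phi>'"
    "\<And>D x. D \<in> T \<Longrightarrow> D (\<Phi> (e (\<Phi>' x))) = \<Phi> (e (\<Phi>' (D x)))"
proof -
  obtain \<Theta> \<Theta>' B where \<Theta>: "inverse_automorphisms \<Theta> \<Theta>'" and B: "B \<subseteq> eigenvectors"
    "center \<subseteq> span (derived \<union> B)" "\<And>b. b \<in> B \<Longrightarrow> \<exists>c. \<Theta> (e (\<Theta>' b)) = scale c b"
    using align_idempotent[OF e] by blast
  have "\<Theta> (e (\<Theta>' (\<Theta> (e (\<Theta>' x))))) = \<Theta> (e (\<Theta>' x))" for x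
    using \<Theta> e by (simp add: inverse_automorphisms_def)
  then obtain \<Psi> \<Psi>' where \<Psi>: "inverse_automorphisms \<Psi> \<Psi>'"
    "\<And>D x. D \<in> T \<Longrightarrow> D (\<Psi> (\<Theta> (e (\<Theta>' (\<Psi>' x))))) = \<Psi> (\<Theta> (e (\<Theta>' (\<Psi>' (D x)))))"
    using conjugate_aligned_idempotent[OF centroid_conjugate[OF \<Theta> e(1)] _ B] by blast
  show thesis
    by (rule that[OF inverse_automorphisms_compose[OF \<Psi>(1) \<Theta>]]) (rule \<Psi>(2))
qed

end

section \<open>Abelian groups given by generators and relations\<close>

definition relators :: "('w \<times> 'w \<times> 'w) set \<Rightarrow> ('w \<Rightarrow>\<^sub>0 int) set"
  where "relators R = {frag_of \<alpha> + frag_of \<beta> - frag_of \<gamma> | \<alpha> \<beta> \<gamma>. (\<alpha>, \<beta>, \<gamma>) \<in> R}"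

definition relator_group :: "'w set \<Rightarrow> ('w \<times> 'w \<times> 'w) set \<Rightarrow> ('w \<Rightarrow>\<^sub>0 int) set"
  where "relator_group \<Omega> R = generate (free_Abelian_group \<Omega>) (relators R)"

text \<open>With one generator for each weight and one triple for each pair of layers with non-zero
  bracket, this is the universal grading group: only a non-zero bracket forces a relation between
  weights.\<close>

definition presented_group :: "'w set \<Rightarrow> ('w \<times> 'w \<times> 'w) set \<Rightarrow> ('w \<Rightarrow>\<^sub>0 int) set monoid"
  where "presented_group \<Omega> R = free_Abelian_group \<Omega> Mod relator_group \<Omega> R"

definition presented_gen :: "'w set \<Rightarrow> ('w \<times> 'w \<times> 'w) set \<Rightarrow> 'w \<Rightarrow> ('w \<Rightarrow>\<^sub>0 int) set"
  where "presented_gen \<Omega> R \<alpha> = relator_group \<Omega> R #>\<^bsub>free_Abelian_group \<Omega>\<^esub> frag_of \<alpha>"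

context
  fixes \<Omega> :: "'w set" and R :: "('w \<times> 'w \<times> 'w) set"
  assumes R: "R \<subseteq> \<Omega> \<times> \<Omega> \<times> \<Omega>"
begin

interpretation F: comm_group "free_Abelian_group \<Omega>"
  by (rule abelian_free_Abelian_group)

lemma keys_relators: "r \<in> relators R \<Longrightarrow> Poly_Mapping.keys r \<subseteq> \<Omega>"
proof -
  assume "r \<in> relators R"
  then obtain \<alpha> \<beta> \<gamma> where r: "r = frag_of \<alpha> + frag_of \<beta> - frag_of \<gamma>" "(\<alpha>, \<beta>, \<gamma>) \<in> R"
    by (auto simp: relators_def)
  have "Poly_Mapping.keys r \<subseteq> Poly_Mapping.keys (frag_of \<alpha> + frag_of \<beta>) \<union> Poly_Mapping.keys (frag_of \<gamma>)"
    unfolding r by (rule keys_diff)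
  also have "\<dots> \<subseteq> (Poly_Mapping.keys (frag_of \<alpha>) \<union> Poly_Mapping.keys (frag_of \<beta>)) \<union> Poly_Mapping.keys (frag_of \<gamma>)"
    by (intro Un_mono keys_add order_refl)
  also have "\<dots> \<subseteq> \<Omega>" using r R by auto
  finally show ?thesis .
qed

lemma subgroup_relator_group: "subgroup (relator_group \<Omega> R) (free_Abelian_group \<Omega>)"
  unfolding relator_group_def using keys_relators
  by (intro F.generate_is_subgroup) auto

lemma normal_relator_group: "relator_group \<Omega> R \<lhd> free_Abelian_group \<Omega>"
  by (rule F.subgroup_imp_normal[OF subgroup_relator_group])

interpretation N: normal "relator_group \<Omega> R" "free_Abelian_group \<Omega>"
  by (rule normal_relator_group)

lemma comm_group_presented: "comm_group (presented_group \<Omega> R)"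
  unfolding presented_group_def by (rule F.abelian_FactGroup[OF subgroup_relator_group])

lemma presented_gen_carrier: "\<alpha> \<in> \<Omega> \<Longrightarrow> presented_gen \<Omega> R \<alpha> \<in> carrier (presented_group \<Omega> R)"
  unfolding presented_group_def presented_gen_def by (auto simp: FactGroup_def RCOSETS_def)

lemma coset_hom:
  "(\<lambda>x. relator_group \<Omega> R #>\<^bsub>free_Abelian_group \<Omega>\<^esub> x) \<in> hom (free_Abelian_group \<Omega>) (presented_group \<Omega> R)"
  unfolding presented_group_def by (rule N.r_coset_hom_Mod)

lemma coset_eq_one_iff:
  assumes "Poly_Mapping.keys x \<subseteq> \<Omega>"
  shows "relator_group \<Omega> R #>\<^bsub>free_Abelian_group \<Omega>\<^esub> x = \<one>\<^bsub>presented_group \<Omega> R\<^esub> \<longleftrightarrow> x \<in> relator_group \<Omega> R"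
  unfolding presented_group_def
  using assms F.coset_join1[OF _ _ subgroup_relator_group, of x] F.coset_join2[OF _ subgroup_relator_group, of x]
    subgroup.subset[OF subgroup_relator_group] by (auto simp: FactGroup_def)

lemma presented_relation:
  assumes "(\<alpha>, \<beta>, \<gamma>) \<in> R"
  shows "presented_gen \<Omega> R \<alpha> \<otimes>\<^bsub>presented_group \<Omega> R\<^esub> presented_gen \<Omega> R \<beta> = presented_gen \<Omega> R \<gamma>"
proof -
  let ?q = "\<lambda>x. relator_group \<Omega> R #>\<^bsub>free_Abelian_group \<Omega>\<^esub> x"
  interpret P: comm_group "presented_group \<Omega> R" by (rule comm_group_presented)
  have \<Omega>: "\<alpha> \<in> \<Omega>" "\<beta> \<in> \<Omega>" "\<gamma> \<in> \<Omega>" using assms R by auto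
  let ?r = "frag_of \<alpha> + frag_of \<beta> - frag_of \<gamma>"
  have r: "?r \<in> relators R" using assms by (auto simp: relators_def)
  then have "?r \<in> relator_group \<Omega> R"
    unfolding relator_group_def by (rule generate.incl)
  then have one: "?q ?r = \<one>\<^bsub>presented_group \<Omega> R\<^esub>"
    using coset_eq_one_iff keys_relators r by blast
  have "?q (frag_of \<alpha>) \<otimes>\<^bsub>presented_group \<Omega> R\<^esub> ?q (frag_of \<beta>) = ?q (frag_of \<alpha> + frag_of \<beta>)"
    using hom_mult[OF coset_hom, of "frag_of \<alpha>" "frag_of \<beta>"] \<Omega> by simp
  also have "\<dots> = ?q (?r + frag_of \<gamma>)" by simp
  also have "\<dots> = ?q ?r \<otimes>\<^bsub>presented_group \<Omega> R\<^esub> ?q (frag_of \<gamma>)"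
    using hom_mult[OF coset_hom, of ?r "frag_of \<gamma>"] \<Omega> keys_relators[OF r] by simp
  also have "\<dots> = ?q (frag_of \<gamma>)"
    using one hom_in_carrier[OF coset_hom, of "frag_of \<gamma>"] \<Omega> by simp
  finally show ?thesis by (simp add: presented_gen_def)
qed

text \<open>The map extends to the free abelian group, and the condition on triples puts the
  relators into the kernel of the extension, so it factors through the quotient.\<close>

lemma presented_hom_exists:
  assumes B: "comm_group B" and f: "f ` \<Omega> \<subseteq> carrier B"
    and rel: "\<And>\<alpha> \<beta> \<gamma>. (\<alpha>, \<beta>, \<gamma>) \<in> R \<Longrightarrow> f \<alpha> \<otimes>\<^bsub>B\<^esub> f \<beta> = f \<gamma>"
  obtains h where "h \<in> hom (presented_group \<Omega> R) B" "\<And>\<alpha>. \<alpha> \<in> \<Omega> \<Longrightarrow> h (presented_gen \<Omega> R \<alpha>) = f \<alpha>"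
proof -
  interpret B: comm_group B by (rule B)
  obtain g where g: "g \<in> hom (free_Abelian_group \<Omega>) B" "\<And>x. x \<in> \<Omega> \<Longrightarrow> g (frag_of x) = f x"
    using B.free_Abelian_group_universal[OF f] by blast
  interpret g: group_hom "free_Abelian_group \<Omega>" B g
    by (rule group_hom.intro) (simp_all add: group_hom_axioms_def g B.is_group)
  have "relators R \<subseteq> kernel (free_Abelian_group \<Omega>) B g"
  proof
    fix r assume r: "r \<in> relators R"
    then obtain \<alpha> \<beta> \<gamma> where r_eq: "r = frag_of \<alpha> + frag_of \<beta> - frag_of \<gamma>" "(\<alpha>, \<beta>, \<gamma>) \<in> R"
      by (auto simp: relators_def)
    then have \<Omega>: "\<alpha> \<in> \<Omega>" "\<beta> \<in> \<Omega>" "\<gamma> \<in> \<Omega>" using R by auto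
    then have fc: "f \<alpha> \<in> carrier B" "f \<beta> \<in> carrier B" "f \<gamma> \<in> carrier B" using f by auto
    have "g (r + frag_of \<gamma>) = g r \<otimes>\<^bsub>B\<^esub> g (frag_of \<gamma>)"
      using g.hom_mult[of r "frag_of \<gamma>"] keys_relators[OF r] \<Omega> by simp
    moreover have "g (r + frag_of \<gamma>) = g (frag_of \<alpha>) \<otimes>\<^bsub>B\<^esub> g (frag_of \<beta>)"
      using g.hom_mult[of "frag_of \<alpha>" "frag_of \<beta>"] \<Omega> by (simp add: r_eq)
    moreover have "g r \<in> carrier B" using g.hom_closed[of r] keys_relators[OF r] by simp
    ultimately have "g r \<otimes>\<^bsub>B\<^esub> f \<gamma> = f \<gamma>" "g r \<in> carrier B"
      using g(2) \<Omega> rel[OF r_eq(2)] by simp_all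
    then have "g r = \<one>\<^bsub>B\<^esub>"
      using B.r_cancel_one fc(3) by blast
    then show "r \<in> kernel (free_Abelian_group \<Omega>) B g"
      using keys_relators[OF r] by (simp add: kernel_def)
  qed
  then have "relator_group \<Omega> R \<subseteq> kernel (free_Abelian_group \<Omega>) B g"
    unfolding relator_group_def by (rule F.generate_subgroup_incl[OF _ g.subgroup_kernel])
  then obtain h where "h \<in> hom (free_Abelian_group \<Omega> Mod relator_group \<Omega> R) B"
    "\<And>x. x \<in> carrier (free_Abelian_group \<Omega>) \<Longrightarrow> h (relator_group \<Omega> R #>\<^bsub>free_Abelian_group \<Omega>\<^esub> x) = g x"
    using g.FactGroup_universal_kernel[OF normal_relator_group] by blast
  then show thesis
    using g by (intro that[of h]) (simp_all add: presented_group_def presented_gen_def)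
qed

lemma presented_hom_unique:
  assumes B: "group B" and h: "h \<in> hom (presented_group \<Omega> R) B" "h' \<in> hom (presented_group \<Omega> R) B"
    and gens: "\<And>\<alpha>. \<alpha> \<in> \<Omega> \<Longrightarrow> h (presented_gen \<Omega> R \<alpha>) = h' (presented_gen \<Omega> R \<alpha>)"
    and u: "u \<in> carrier (presented_group \<Omega> R)"
  shows "h u = h' u"
proof -
  let ?q = "\<lambda>x. relator_group \<Omega> R #>\<^bsub>free_Abelian_group \<Omega>\<^esub> x"
  have hom: "(\<lambda>x. g (?q x)) \<in> hom (free_Abelian_group \<Omega>) B" if "g \<in> hom (presented_group \<Omega> R) B" for g
    using hom_compose[OF coset_hom that] by (simp add: comp_def)
  interpret g: group_hom "free_Abelian_group \<Omega>" B "\<lambda>x. h (?q x)"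
    by (rule group_hom.intro) (simp_all add: group_hom_axioms_def hom h B)
  interpret g': group_hom "free_Abelian_group \<Omega>" B "\<lambda>x. h' (?q x)"
    by (rule group_hom.intro) (simp_all add: group_hom_axioms_def hom h B)
  obtain x where x: "Poly_Mapping.keys x \<subseteq> \<Omega>" "u = ?q x"
    using u by (auto simp: presented_group_def FactGroup_def RCOSETS_def)
  have "h (?q x) = h' (?q x)"
  proof (rule free_Abelian_group_induct[OF x(1), where P = "\<lambda>x. h (?q x) = h' (?q x)"])
    show "h (?q 0) = h' (?q 0)" using g.hom_one g'.hom_one by simp
  next
    fix x y
    assume xy: "Poly_Mapping.keys x \<subseteq> \<Omega>" "Poly_Mapping.keys y \<subseteq> \<Omega>" "h (?q x) = h' (?q x)" "h (?q y) = h' (?q y)"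
    have diff: "x \<otimes>\<^bsub>free_Abelian_group \<Omega>\<^esub> inv\<^bsub>free_Abelian_group \<Omega>\<^esub> y = x - y"
      using xy by simp
    show "h (?q (x - y)) = h' (?q (x - y))"
      using xy g.hom_mult[of x "inv\<^bsub>free_Abelian_group \<Omega>\<^esub> y"] g'.hom_mult[of x "inv\<^bsub>free_Abelian_group \<Omega>\<^esub> y"]
        g.hom_inv[of y] g'.hom_inv[of y] unfolding diff by simp
  next
    fix a assume "a \<in> \<Omega>"
    then show "h (?q (frag_of a)) = h' (?q (frag_of a))" using gens by (simp add: presented_gen_def)
  qed
  then show ?thesis by (simp add: x)
qed

text \<open>An element of the free group is determined by its list of integer coefficients.
  Countability allows the presented group to be copied into any infinite type.\<close>

lemma countable_presented:
  assumes "finite \<Omega>" shows "countable (carrier (presented_group \<Omega> R))"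
proof -
  obtain ws where ws: "set ws = \<Omega>" using finite_list[OF assms] by blast
  have "inj_on (\<lambda>x. map (poly_mapping.lookup x) ws) (carrier (free_Abelian_group \<Omega>))"
  proof (rule inj_onI)
    fix x y :: "'w \<Rightarrow>\<^sub>0 int"
    assume keys: "x \<in> carrier (free_Abelian_group \<Omega>)" "y \<in> carrier (free_Abelian_group \<Omega>)"
      and eq: "map (poly_mapping.lookup x) ws = map (poly_mapping.lookup y) ws"
    show "x = y"
    proof (rule poly_mapping_eqI)
      show "poly_mapping.lookup x a = poly_mapping.lookup y a" for a
        using keys eq ws by (cases "a \<in> \<Omega>") (auto simp: in_keys_iff subset_iff, metis)
    qed
  qed
  then have "countable (carrier (free_Abelian_group \<Omega>))"
    by (rule countable_image_inj_on[rotated]) simp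
  then show ?thesis
    by (simp add: presented_group_def FactGroup_def RCOSETS_def)
qed

end

section \<open>Detecting torsion by additive functions with rational values\<close>

interpretation rat_fun: vector_space "\<lambda>(c::rat) (f::'w \<Rightarrow> rat) x. c * f x"
  by unfold_locales (simp_all add: fun_eq_iff algebra_simps)

interpretation rat_self: vector_space "(*) :: rat \<Rightarrow> rat \<Rightarrow> rat"
  by unfold_locales (simp_all add: algebra_simps)

interpretation rat_fun_pair: vector_space_pair "\<lambda>(c::rat) (f::'w \<Rightarrow> rat) x. c * f x" "(*) :: rat \<Rightarrow> rat \<Rightarrow> rat"
  by unfold_locales

text \<open>Linear duality over the rationals. If the generator \<open>w\<close> were outside the
  rational span of the relators, some functional would vanish on the relators and be 1 at
  \<open>w\<close>, and would restrict to an additive function on the generators. So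
  \<open>w\<close> is a rational combination of relators, and clearing denominators puts a positive
  multiple of it into the relator group.\<close>

lemma presented_torsion:
  fixes \<Omega> :: "'w set"
  assumes R: "R \<subseteq> \<Omega> \<times> \<Omega> \<times> \<Omega>" and w: "w \<in> \<Omega>"
    and additive: "\<And>f :: 'w \<Rightarrow> rat. (\<And>\<alpha> \<beta> \<gamma>. (\<alpha>, \<beta>, \<gamma>) \<in> R \<Longrightarrow> f \<alpha> + f \<beta> = f \<gamma>) \<Longrightarrow> f w = 0"
  obtains n :: nat where "n > 0"
    "presented_gen \<Omega> R w [^]\<^bsub>presented_group \<Omega> R\<^esub> n = \<one>\<^bsub>presented_group \<Omega> R\<^esub>"
proof -
  interpret F: comm_group "free_Abelian_group \<Omega>" by (rule abelian_free_Abelian_group)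
  interpret P: comm_group "presented_group \<Omega> R" by (rule comm_group_presented[OF R])
  note sub = subgroup_relator_group[OF R]
  define j :: "('w \<Rightarrow>\<^sub>0 int) \<Rightarrow> 'w \<Rightarrow> rat" where "j c = (\<lambda>a. of_int (poly_mapping.lookup c a))" for c
  \<comment> \<open>The rational vectors with a positive integer multiple in the relator group. Once
    \<open>H\<close> is known to be a subspace it contains the rational span of the relators, which
    is the clearing of denominators.\<close>
  define H where "H = {v. \<exists>n>0. \<exists>c\<in>relator_group \<Omega> R. (\<lambda>a. of_nat n * v a) = j c}"
  have N_0: "0 \<in> relator_group \<Omega> R"
    using subgroup.one_closed[OF sub] by simp
  have N_add: "c + d \<in> relator_group \<Omega> R" if "c \<in> relator_group \<Omega> R" "d \<in> relator_group \<Omega> R" for c d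
    using subgroup.m_closed[OF sub that] by simp
  have N_cmul: "frag_cmul k c \<in> relator_group \<Omega> R" if "c \<in> relator_group \<Omega> R" for k c
    using F.subgroup_int_pow_closed[OF sub that, of k] subgroup.mem_carrier[OF sub that] by simp
  have j_add: "j (c + d) = j c + j d" for c d
    by (simp add: j_def fun_eq_iff lookup_add)
  have j_cmul: "j (frag_cmul k c) = (\<lambda>a. of_int k * j c a)" for k c
    by (simp add: j_def)
  have H_I: "v \<in> H" if "n > 0" "c \<in> relator_group \<Omega> R" "(\<lambda>a. of_nat n * v a) = j c" for n c v
    unfolding H_def using that by blast
  have "rat_fun.subspace H"
  proof (rule rat_fun.subspaceI)
    have "(\<lambda>a. of_nat 1 * (0::'w \<Rightarrow> rat) a) = j 0" by (simp add: j_def fun_eq_iff)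
    then show "0 \<in> H" by (rule H_I[OF zero_less_one N_0])
  next
    fix u v assume "u \<in> H" "v \<in> H"
    then obtain n c m d where nm: "n > 0" "c \<in> relator_group \<Omega> R" "(\<lambda>a. of_nat n * u a) = j c"
      "m > 0" "d \<in> relator_group \<Omega> R" "(\<lambda>a. of_nat m * v a) = j d"
      unfolding H_def by blast
    have eq: "(\<lambda>a. of_nat (n * m) * (u + v) a) = j (frag_cmul (int m) c + frag_cmul (int n) d)"
    proof (rule ext)
      fix a
      have "j c a = of_nat n * u a" "j d a = of_nat m * v a"
        using fun_cong[OF nm(3), of a] fun_cong[OF nm(6), of a] by simp_all
      moreover have "j (frag_cmul (int m) c + frag_cmul (int n) d) a = of_nat m * j c a + of_nat n * j d a"
        by (simp only: j_add j_cmul plus_fun_apply of_int_of_nat_eq)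
      ultimately show "of_nat (n * m) * (u + v) a = j (frag_cmul (int m) c + frag_cmul (int n) d) a"
        by (simp only: plus_fun_apply of_nat_mult distrib_left mult.assoc mult.left_commute)
    qed
    have "n * m > 0" using nm by simp
    then show "u + v \<in> H"
      by (rule H_I[OF _ N_add[OF N_cmul[OF nm(2)] N_cmul[OF nm(5)]] eq])
  next
    fix q :: rat and v assume "v \<in> H"
    then obtain n c where nc: "n > 0" "c \<in> relator_group \<Omega> R" "(\<lambda>a. of_nat n * v a) = j c"
      unfolding H_def by blast
    \<comment> \<open>For q = s/t the multiplier \<open>n\<close> grows by the denominator
      \<open>t\<close>, and the relator is multiplied by the numerator \<open>s\<close>.\<close>
    obtain s t where st: "quotient_of q = (s, t)" by (cases "quotient_of q")
    then have t: "t > 0" and q: "q = of_int s / of_int t"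
      using quotient_of_denom_pos quotient_of_div by auto
    have eq: "(\<lambda>a. of_nat (n * nat t) * (q * v a)) = j (frag_cmul s c)"
    proof (rule ext)
      fix a
      have "j c a = of_nat n * v a"
        using fun_cong[OF nc(3), of a] by simp
      moreover have "of_nat (n * nat t) * q = of_nat n * of_int s"
        using t by (simp add: q)
      ultimately show "of_nat (n * nat t) * (q * v a) = j (frag_cmul s c) a"
        by (simp only: j_cmul mult.assoc[symmetric]) (simp only: mult.assoc mult.commute)
    qed
    have "n * nat t > 0" using nc t by simp
    then show "(\<lambda>a. q * v a) \<in> H"
      by (rule H_I[OF _ N_cmul[OF nc(2)] eq])
  qed
  moreover have "j ` relators R \<subseteq> H"
  proof
    fix v assume "v \<in> j ` relators R"
    then obtain r where r: "r \<in> relators R" "v = j r" by blast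
    then have "r \<in> relator_group \<Omega> R" unfolding relator_group_def by (intro generate.incl)
    moreover have "(\<lambda>a. of_nat 1 * v a) = j r" by (simp add: r)
    ultimately show "v \<in> H" by (intro H_I[OF zero_less_one])
  qed
  ultimately have span_H: "rat_fun.span (j ` relators R) \<subseteq> H"
    by (rule rat_fun.span_minimal[rotated])
  have "j (frag_of w) \<in> rat_fun.span (j ` relators R)"
  proof (rule ccontr)
    assume notin: "j (frag_of w) \<notin> rat_fun.span (j ` relators R)"
    obtain B where B: "B \<subseteq> j ` relators R" "rat_fun.independent B" "j ` relators R \<subseteq> rat_fun.span B"
      by (rule rat_fun.maximal_independent_subset)
    have "j (frag_of w) \<notin> rat_fun.span B"
      using notin rat_fun.span_mono[OF B(1)] by blast
    then have "rat_fun.independent (insert (j (frag_of w)) B)"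
      using B(2) by (rule rat_fun.independent_insertI)
    then obtain g where g: "Vector_Spaces.linear (\<lambda>(c::rat) (f::'w \<Rightarrow> rat) x. c * f x) (*) g"
      "\<forall>x\<in>insert (j (frag_of w)) B. g x = (if x \<in> B then 0 else 1)"
      using rat_fun_pair.linear_independent_extend[of _ "\<lambda>x. if x \<in> B then 0 else 1"] by blast
    have zero: "g v = 0" if "v \<in> j ` relators R" for v
      by (rule rat_fun_pair.linear_eq_0_on_span[OF g(1), where b = B]) (use g(2) B(3) that in auto)
    have "g (j (frag_of w)) = 1"
      using g(2) \<open>j (frag_of w) \<notin> rat_fun.span B\<close> rat_fun.span_base by auto
    moreover have "g (j (frag_of w)) = 0"
    proof (rule additive[of "\<lambda>\<alpha>. g (j (frag_of \<alpha>))"])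
      fix \<alpha> \<beta> \<gamma> assume "(\<alpha>, \<beta>, \<gamma>) \<in> R"
      then have "g (j (frag_of \<alpha> + frag_of \<beta> - frag_of \<gamma>)) = 0"
        by (intro zero) (auto simp: relators_def)
      moreover have "j (frag_of \<alpha> + frag_of \<beta> - frag_of \<gamma>) + j (frag_of \<gamma>) = j (frag_of \<alpha>) + j (frag_of \<beta>)"
        by (simp flip: j_add)
      ultimately show "g (j (frag_of \<alpha>)) + g (j (frag_of \<beta>)) = g (j (frag_of \<gamma>))"
        using rat_fun_pair.linear_add[OF g(1)] by (metis add_0_left)
    qed
    ultimately show False by simp
  qed
  with span_H obtain n c where nc: "n > 0" "c \<in> relator_group \<Omega> R" "(\<lambda>a. of_nat n * j (frag_of w) a) = j c"
    unfolding H_def by blast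
  have "frag_cmul (int n) (frag_of w) = c"
  proof (rule poly_mapping_eqI)
    fix a
    have "(of_int (poly_mapping.lookup (frag_cmul (int n) (frag_of w)) a) :: rat) = of_int (poly_mapping.lookup c a)"
      using fun_cong[OF nc(3), of a] by (simp add: j_def)
    then show "poly_mapping.lookup (frag_cmul (int n) (frag_of w)) a = poly_mapping.lookup c a"
      by (simp only: of_int_eq_iff)
  qed
  then have in_N: "frag_cmul (int n) (frag_of w) \<in> relator_group \<Omega> R" using nc by simp
  have keys: "Poly_Mapping.keys (frag_cmul (int n) (frag_of w)) \<subseteq> \<Omega>"
    using subgroup.mem_carrier[OF sub in_N] by simp
  interpret q: group_hom "free_Abelian_group \<Omega>" "presented_group \<Omega> R" "\<lambda>x. relator_group \<Omega> R #>\<^bsub>free_Abelian_group \<Omega>\<^esub> x"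
    by (rule group_hom.intro) (simp_all add: group_hom_axioms_def coset_hom[OF R])
  have "presented_gen \<Omega> R w [^]\<^bsub>presented_group \<Omega> R\<^esub> n
      = relator_group \<Omega> R #>\<^bsub>free_Abelian_group \<Omega>\<^esub> (frag_cmul (int n) (frag_of w))"
    using q.hom_nat_pow[of "frag_of w" n] w by (simp add: presented_gen_def)
  also have "\<dots> = \<one>\<^bsub>presented_group \<Omega> R\<^esub>"
    using coset_eq_one_iff[OF R keys] in_N by simp
  finally show thesis using that nc(1) by blast
qed

section \<open>Universal realizations of torus gradings\<close>

context fd_lie_algebra
begin

text \<open>\<open>E\<close> will be a spanning set that may be dependent, so that images of an
  eigenbasis under the projections to a factor can be used directly.\<close>

definition diagonal_derivations :: "'a set \<Rightarrow> ('a \<Rightarrow> 'a) set"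
  where "diagonal_derivations E = {D \<in> derivations. \<forall>e\<in>E. \<exists>c. D e = scale c e}"

lemma split_torus_diagonal:
  assumes E: "span E = UNIV"
  shows "split_torus (diagonal_derivations E)"
proof -
  note lin_D = derivationD(1) and lin_s = lin_simps[OF derivationD(1)]
  have add: "(\<lambda>x. D x + D' x) \<in> diagonal_derivations E"
    if D: "D \<in> diagonal_derivations E" "D' \<in> diagonal_derivations E" for D D'
  proof -
    have der: "D \<in> derivations" "D' \<in> derivations" using D by (auto simp: diagonal_derivations_def)
    have "(\<lambda>x. D x + D' x) \<in> derivations"
      using der by (auto simp: derivations_def bracket_add_left bracket_add_right intro!: linI)
        (simp_all add: lin_simps scale_right_distrib)
    moreover have "\<exists>c. D e + D' e = scale c e" if e: "e \<in> E" for e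
    proof -
      obtain c c' where "D e = scale c e" "D' e = scale c' e"
        using D e unfolding diagonal_derivations_def by blast
      then show ?thesis by (metis scale_left_distrib)
    qed
    ultimately show ?thesis by (simp add: diagonal_derivations_def)
  qed
  have scale: "(\<lambda>x. scale a (D x)) \<in> diagonal_derivations E"
    if D: "D \<in> diagonal_derivations E" for a D
  proof -
    have der: "D \<in> derivations" using D by (auto simp: diagonal_derivations_def)
    have "(\<lambda>x. scale a (D x)) \<in> derivations"
      using der by (auto simp: derivations_def bracket_scale_left bracket_scale_right
          scale_right_distrib intro!: linI)
        (simp_all add: lin_simps scale_right_distrib mult.commute)
    moreover have "\<exists>c. scale a (D e) = scale c e" if e: "e \<in> E" for e
      using D e by (force simp: diagonal_derivations_def)
    ultimately show ?thesis by (simp add: diagonal_derivations_def)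
  qed
  have zero: "(\<lambda>x. 0) \<in> diagonal_derivations E"
    by (auto simp: diagonal_derivations_def derivations_def intro!: linI exI[of _ 0])
  have commute: "D (D' x) - D' (D x) = 0"
    if D: "D \<in> diagonal_derivations E" "D' \<in> diagonal_derivations E" for D D' x
  proof -
    have der: "D \<in> derivations" "D' \<in> derivations" using D by (auto simp: diagonal_derivations_def)
    have "D (D' x) = D' (D x)"
    proof (rule endo.linear_eq_on_span[where f = "\<lambda>x. D (D' x)" and B = E])
      show "lin (\<lambda>x. D (D' x))" "lin (\<lambda>x. D' (D x))"
        by (auto intro!: linI simp: lin_s der)
      show "D (D' e) = D' (D e)" if e: "e \<in> E" for e
      proof -
        obtain c c' where "D e = scale c e" "D' e = scale c' e"
          using D e unfolding diagonal_derivations_def by blast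
        then show ?thesis by (simp add: lin_s der mult.commute)
      qed
    qed (simp add: E)
    then show ?thesis by simp
  qed
  \<comment> \<open>A split torus asks for an independent set; a basis chosen inside
    \<open>E\<close> still consists of common eigenvectors.\<close>
  obtain B where B: "B \<subseteq> E" "independent B" "E \<subseteq> span B"
    by (rule maximal_independent_subset)
  have "span B = UNIV"
    using span_minimal[OF B(3) subspace_span] E by auto
  moreover have "\<forall>e\<in>B. \<forall>\<delta>\<in>diagonal_derivations E. \<exists>c. \<delta> e = scale c e"
    using B(1) by (auto simp: diagonal_derivations_def)
  ultimately show ?thesis
    unfolding split_torus_def using add scale zero commute B(2)
    by (intro conjI) (auto simp: diagonal_derivations_def)
qed

text \<open>This is how derivations built later, from additive functions on the weights or by
  extension from a factor, are recognized as members of \<open>T\<close>.\<close>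

lemma maximal_split_torus_diagonal:
  assumes T: "maximal_split_torus T" and E: "span E = UNIV"
    and eigen: "\<And>e D. e \<in> E \<Longrightarrow> D \<in> T \<Longrightarrow> \<exists>c. D e = scale c e"
  shows "T = diagonal_derivations E"
proof -
  have "T \<subseteq> diagonal_derivations E"
    using T eigen by (auto simp: diagonal_derivations_def maximal_split_torus_def split_torus_def)
  then show ?thesis
    using T split_torus_diagonal[OF E] unfolding maximal_split_torus_def by blast
qed

text \<open>A non-zero vector in two layers would have two decompositions, each concentrated at a
  single index.\<close>

lemma grading_layers_disjoint:
  assumes "grading A V" "i \<in> carrier A" "j \<in> carrier A" "x \<in> V i" "x \<in> V j" "x \<noteq> 0"
  shows "i = j"
proof -
  have ds: "direct_sum_of (carrier A) V" using assms(1) by (simp add: grading_def)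
  then have zero: "0 \<in> V i" if "i \<in> carrier A" for i
    using that subspace_0 by (auto simp: direct_sum_of_def)
  define single where "single i = (\<lambda>l. if l = i then x else 0)" for i :: 'b
  have supp: "{l. single i l \<noteq> 0} = {i}" for i
    using assms(6) by (auto simp: single_def)
  have single: "(\<forall>l\<in>carrier A. single i l \<in> V l) \<and> (\<forall>l. l \<notin> carrier A \<longrightarrow> single i l = 0) \<and>
      finite {l. single i l \<noteq> 0} \<and> x = (\<Sum>l | single i l \<noteq> 0. single i l)"
    if "i \<in> carrier A" "x \<in> V i" for i
    unfolding supp using that zero by (auto simp: single_def)
  have "single i = single j"
    using ds single[OF assms(2,4)] single[OF assms(3,5)] unfolding direct_sum_of_def by blast
  then have "single i i = single j i" by simp
  then show ?thesis using assms(6) by (auto simp: single_def split: if_splits)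
qed

lemma split_torus_basis:
  assumes "split_torus T"
  obtains E where "torus_family scale bracket Basis T E"
proof -
  obtain E where E: "independent E" "span E = UNIV" "\<forall>e\<in>E. \<forall>\<delta>\<in>T. \<exists>c. \<delta> e = scale c e"
    using assms unfolding split_torus_def by blast
  have T: "T \<subseteq> derivations" using assms by (simp add: split_torus_def)
  have "diag_family scale bracket Basis T E"
    by (rule diag_family.intro[OF fd_lie_algebra_axioms], rule diag_family_axioms.intro)
      (use T E derivationD(1) in auto)
  then have "torus_family scale bracket Basis T E"
    by (rule torus_family.intro) (rule torus_family_axioms.intro[OF T])
  then show thesis by (rule that)
qed

end

section \<open>Realizations of the grading induced by a maximal split torus\<close>

locale maximal_torus_family = torus_family scale bracket Basis T E
  for scale :: "'k::field_char_0 \<Rightarrow> 'a::ab_group_add \<Rightarrow> 'a"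
    and bracket :: "'a \<Rightarrow> 'a \<Rightarrow> 'a" and Basis :: "'a set" and T E +
  assumes maximal: "maximal_split_torus T"
begin

abbreviation \<Omega> where "\<Omega> \<equiv> weights (dual_group T) (torus_layer T)"

lemma nonzero_layer_weight:
  assumes "x \<in> torus_layer T \<alpha>" "\<alpha> \<in> extensional T" "x \<noteq> 0" shows "\<alpha> \<in> weight ` E"
  using layer_proj_id[OF assms(1,2)] layer_proj_outside[of \<alpha> x] assms(3) by metis

lemma E_nonzero: "b \<in> E \<Longrightarrow> b \<noteq> 0"
  using indep_E dependent_zero by blast

lemma basis_in_layer: "b \<in> E \<Longrightarrow> b \<in> torus_layer T (weight b)"
  by (simp add: torus_layer_def weight_eigen)

lemma weight_in_dual:
  assumes b: "b \<in> E" shows "weight b \<in> carrier (dual_group T)"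
proof -
  have cancel: "c = d" if "scale c b = scale d b" for c d
    using that E_nonzero[OF b] by simp
  have "weight b (\<lambda>x. D x + D' x) = weight b D + weight b D'" if D: "D \<in> T" "D' \<in> T" for D D'
  proof (rule cancel)
    have "(\<lambda>x. D x + D' x) \<in> T"
      using maximal D by (simp add: maximal_split_torus_def split_torus_def)
    from weight_eigen[OF b this] show "scale (weight b (\<lambda>x. D x + D' x)) b = scale (weight b D + weight b D') b"
      by (simp add: weight_eigen[OF b] D scale_left_distrib)
  qed
  moreover have "weight b (\<lambda>x. scale c (D x)) = c * weight b D" if D: "D \<in> T" for c D
  proof (rule cancel)
    have "(\<lambda>x. scale c (D x)) \<in> T"
      using maximal D by (simp add: maximal_split_torus_def split_torus_def)
    from weight_eigen[OF b this] show "scale (weight b (\<lambda>x. scale c (D x))) b = scale (c * weight b D) b"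
      by (auto simp: weight_eigen[OF b D])
  qed
  ultimately show ?thesis
    using weight_extensional by (simp add: dual_group_def)
qed

lemma weights_eq: "\<Omega> = weight ` E"
proof
  show "\<Omega> \<subseteq> weight ` E"
  proof
    fix \<alpha> assume "\<alpha> \<in> \<Omega>"
    then have \<alpha>: "\<alpha> \<in> extensional T" "torus_layer T \<alpha> \<noteq> {0}"
      by (auto simp: weights_def dual_group_def)
    then obtain x where "x \<in> torus_layer T \<alpha>" "x \<noteq> 0"
      using subspace_0[OF subspace_layer] by blast
    then show "\<alpha> \<in> weight ` E" using nonzero_layer_weight \<alpha> by blast
  qed
  show "weight ` E \<subseteq> \<Omega>"
    using weight_in_dual basis_in_layer E_nonzero by (auto simp: weights_def)
qed

lemma finite_weights: "finite \<Omega>"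
  by (simp add: weights_eq finite_E)

lemma weights_extensional: "\<alpha> \<in> \<Omega> \<Longrightarrow> \<alpha> \<in> extensional T"
  using weight_image_extensional by (simp add: weights_eq)

definition relations :: "((('a \<Rightarrow> 'a) \<Rightarrow> 'k) \<times> (('a \<Rightarrow> 'a) \<Rightarrow> 'k) \<times> (('a \<Rightarrow> 'a) \<Rightarrow> 'k)) set"
  where "relations = {(\<alpha>, \<beta>, \<gamma>). \<alpha> \<in> \<Omega> \<and> \<beta> \<in> \<Omega> \<and> \<gamma> = \<alpha> \<otimes>\<^bsub>dual_group T\<^esub> \<beta> \<and>
    (\<exists>x\<in>torus_layer T \<alpha>. \<exists>y\<in>torus_layer T \<beta>. bracket x y \<noteq> 0)}"

lemma relations_weights: "relations \<subseteq> \<Omega> \<times> \<Omega> \<times> \<Omega>"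
proof -
  have "\<alpha> \<otimes>\<^bsub>dual_group T\<^esub> \<beta> \<in> \<Omega>"
    if "x \<in> torus_layer T \<alpha>" "y \<in> torus_layer T \<beta>" "bracket x y \<noteq> 0" for x y \<alpha> \<beta>
    using nonzero_layer_weight[OF bracket_layers[OF that(1,2)] mult_dual_extensional that(3)]
    by (simp add: weights_eq)
  then show ?thesis unfolding relations_def by blast
qed

text \<open>The torus layers re-indexed along a map \<open>c\<close> into another group. On the
  carrier every realization has this form, so realizations can be handled through their index maps
  alone.\<close>

definition realized_layers :: "((('a \<Rightarrow> 'a) \<Rightarrow> 'k) \<Rightarrow> 'u) \<Rightarrow> 'u \<Rightarrow> 'a set"
  where "realized_layers c u = (if u \<in> c ` \<Omega> then torus_layer T (inv_into \<Omega> c u) else {0})"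

lemma realized_layers_image:
  "inj_on c \<Omega> \<Longrightarrow> \<alpha> \<in> \<Omega> \<Longrightarrow> realized_layers c (c \<alpha>) = torus_layer T \<alpha>"
  by (simp add: realized_layers_def)

lemma subspace_realized_layers: "subspace (realized_layers c u)"
  by (simp add: realized_layers_def subspace_layer)

lemma direct_sum_realized_layers:
  assumes c: "inj_on c \<Omega>" "c ` \<Omega> \<subseteq> I"
  shows "direct_sum_of I (realized_layers c)"
  unfolding direct_sum_of_def
proof (intro conjI ballI allI subspace_realized_layers)
  fix x
  define f where "f u = (if u \<in> c ` \<Omega> then layer_proj (inv_into \<Omega> c u) x else 0)" for u
  have f_c: "f (c \<alpha>) = layer_proj \<alpha> x" if "\<alpha> \<in> \<Omega>" for \<alpha>
    using that c(1) by (simp add: f_def)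
  show "\<exists>!f. (\<forall>i\<in>I. f i \<in> realized_layers c i) \<and> (\<forall>i. i \<notin> I \<longrightarrow> f i = 0) \<and>
    finite {i. f i \<noteq> 0} \<and> x = (\<Sum>i | f i \<noteq> 0. f i)"
  proof (rule ex1I[of _ f], intro conjI ballI allI impI)
    show "f i \<in> realized_layers c i" for i
      by (auto simp: f_def realized_layers_def layer_proj_in)
    show "f i = 0" if "i \<notin> I" for i using that c(2) by (auto simp: f_def)
    have sub: "{i. f i \<noteq> 0} \<subseteq> c ` \<Omega>" by (auto simp: f_def split: if_splits)
    show "finite {i. f i \<noteq> 0}"
      by (rule finite_subset[OF sub finite_imageI[OF finite_weights]])
    have "(\<Sum>i | f i \<noteq> 0. f i) = (\<Sum>i\<in>c ` \<Omega>. f i)"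
      by (rule sum.mono_neutral_left[OF finite_imageI[OF finite_weights] sub]) auto
    also have "\<dots> = (\<Sum>\<alpha>\<in>\<Omega>. layer_proj \<alpha> x)"
      by (simp add: sum.reindex[OF c(1)] f_c)
    also have "\<dots> = x" by (simp add: weights_eq sum_layer_proj)
    finally show "x = (\<Sum>i | f i \<noteq> 0. f i)" by simp
  next
    fix g assume g: "(\<forall>i\<in>I. g i \<in> realized_layers c i) \<and> (\<forall>i. i \<notin> I \<longrightarrow> g i = 0) \<and>
      finite {i. g i \<noteq> 0} \<and> x = (\<Sum>i | g i \<noteq> 0. g i)"
    have off: "g u = 0" if "u \<notin> c ` \<Omega>" for u
      using g that by (cases "u \<in> I") (auto simp: realized_layers_def)
    have on: "g (c \<beta>) \<in> torus_layer T \<beta>" if "\<beta> \<in> \<Omega>" for \<beta>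
      using g that c realized_layers_image[OF c(1) that] by (metis image_subset_iff)
    \<comment> \<open>Projecting a decomposition \<open>g\<close> of \<open>x\<close> to the layer
      at \<alpha> leaves only the term at \<open>c \<alpha>\<close>, which determines
      \<open>g\<close>.\<close>
    have proj: "layer_proj \<alpha> (g v) = (if v = c \<alpha> then g v else 0)" if "\<alpha> \<in> \<Omega>" for \<alpha> v
    proof (cases "v \<in> c ` \<Omega>")
      case True
      then obtain \<beta> where \<beta>: "\<beta> \<in> \<Omega>" "v = c \<beta>" by blast
      then show ?thesis
        using on[OF \<beta>(1)] weights_extensional[OF \<beta>(1)] that c(1)
        by (cases "\<alpha> = \<beta>") (auto simp: layer_proj_id layer_proj_other inj_on_eq_iff)
    next
      case False
      then show ?thesis using off that by (auto simp: lin_simps[OF lin_layer_proj])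
    qed
    show "g = f"
    proof (rule ext)
      fix u
      show "g u = f u"
      proof (cases "u \<in> c ` \<Omega>")
        case True
        then obtain \<alpha> where \<alpha>: "\<alpha> \<in> \<Omega>" "u = c \<alpha>" by blast
        have "layer_proj \<alpha> x = (\<Sum>v | g v \<noteq> 0. layer_proj \<alpha> (g v))"
          using g by (metis lin_simps(6)[OF lin_layer_proj])
        also have "\<dots> = (\<Sum>v | g v \<noteq> 0. if v = u then g u else 0)"
          by (rule sum.cong) (auto simp: proj[OF \<alpha>(1)] \<alpha>(2))
        also have "\<dots> = g u" using g by (simp add: sum.delta)
        finally show ?thesis using f_c[OF \<alpha>(1)] \<alpha>(2) by simp
      next
        case False
        then show ?thesis using off by (simp add: f_def)
      qed
    qed
  qed
qed

lemma realization_realized_layers: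
  assumes B: "comm_group B" and c: "inj_on c \<Omega>" "c ` \<Omega> \<subseteq> carrier B"
    and rel: "\<And>\<alpha> \<beta> \<gamma>. (\<alpha>, \<beta>, \<gamma>) \<in> relations \<Longrightarrow> c \<alpha> \<otimes>\<^bsub>B\<^esub> c \<beta> = c \<gamma>"
  shows "realization (dual_group T) (torus_layer T) B (realized_layers c)"
proof -
  have "bracket x y \<in> realized_layers c (u \<otimes>\<^bsub>B\<^esub> v)"
    if xy: "x \<in> realized_layers c u" "y \<in> realized_layers c v" for x y u v
  proof (cases "bracket x y = 0")
    case True
    then show ?thesis using subspace_0[OF subspace_realized_layers] by simp
  next
    case False
    then have "x \<noteq> 0" "y \<noteq> 0" by auto
    with xy obtain \<alpha> \<beta> where \<alpha>\<beta>: "\<alpha> \<in> \<Omega>" "u = c \<alpha>" "\<beta> \<in> \<Omega>" "v = c \<beta>"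
      by (auto simp: realized_layers_def split: if_splits)
    then have xy': "x \<in> torus_layer T \<alpha>" "y \<in> torus_layer T \<beta>"
      using xy realized_layers_image[OF c(1)] by auto
    then have R: "(\<alpha>, \<beta>, \<alpha> \<otimes>\<^bsub>dual_group T\<^esub> \<beta>) \<in> relations"
      using False \<alpha>\<beta> by (auto simp: relations_def)
    then have "\<alpha> \<otimes>\<^bsub>dual_group T\<^esub> \<beta> \<in> \<Omega>" using relations_weights by blast
    then show ?thesis
      using bracket_layers[OF xy'] rel[OF R] \<alpha>\<beta> realized_layers_image[OF c(1)] by simp
  qed
  then have "grading B (realized_layers c)"
    using B direct_sum_realized_layers[OF c] by (simp add: grading_def)
  moreover have "\<forall>\<beta>\<in>carrier B - c ` \<Omega>. realized_layers c \<beta> = {0}"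
    by (simp add: realized_layers_def)
  ultimately show ?thesis
    using c realized_layers_image[OF c(1)] unfolding realization_def by blast
qed

text \<open>Since \<open>f\<close> is injective on the weights, each fibre of \<open>h\<close>
  contains the index of at most one non-zero layer, so pushing forward merges nothing.\<close>

lemma push_forward_realized_layers:
  assumes c: "inj_on c \<Omega>" "c ` \<Omega> \<subseteq> carrier U"
    and f: "inj_on f \<Omega>" and h: "\<And>\<alpha>. \<alpha> \<in> \<Omega> \<Longrightarrow> h (c \<alpha>) = f \<alpha>"
  shows "push_forward U h (realized_layers c) \<beta> = realized_layers f \<beta>"
proof -
  let ?S = "\<Union>u\<in>{u \<in> carrier U. h u = \<beta>}. realized_layers c u"
  have "span ?S \<subseteq> realized_layers f \<beta>"
  proof (rule span_minimal[OF _ subspace_realized_layers], rule UN_least)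
    fix u assume u: "u \<in> {u \<in> carrier U. h u = \<beta>}"
    show "realized_layers c u \<subseteq> realized_layers f \<beta>"
    proof (cases "u \<in> c ` \<Omega>")
      case True
      then show ?thesis
        using u h realized_layers_image[OF c(1)] realized_layers_image[OF f] by auto
    next
      case False
      then show ?thesis
        using subspace_0[OF subspace_realized_layers] by (simp add: realized_layers_def[of c])
    qed
  qed
  moreover have "realized_layers f \<beta> \<subseteq> span ?S"
  proof (cases "\<beta> \<in> f ` \<Omega>")
    case True
    then obtain \<alpha> where \<alpha>: "\<alpha> \<in> \<Omega>" "\<beta> = f \<alpha>" by blast
    then have "c \<alpha> \<in> {u \<in> carrier U. h u = \<beta>}"
      using h c(2) by auto
    moreover have "realized_layers f \<beta> = realized_layers c (c \<alpha>)"
      using \<alpha> realized_layers_image[OF c(1)] realized_layers_image[OF f] by simp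
    ultimately have "realized_layers f \<beta> \<subseteq> ?S"
      using UN_upper[of "c \<alpha>" "{u \<in> carrier U. h u = \<beta>}" "realized_layers c"] by simp
    then show ?thesis using span_superset[of ?S] by blast
  next
    case False
    then show ?thesis using span_zero by (simp add: realized_layers_def[of f])
  qed
  ultimately show ?thesis
    by (simp add: push_forward_def sum_of_layers_def)
qed

abbreviation "P \<equiv> presented_group \<Omega> relations"
abbreviation "gen \<equiv> presented_gen \<Omega> relations"

lemma dual_comm_group: "comm_group (dual_group T)"
proof -
  have closed: "(\<lambda>x. D x + D' x) \<in> T" "(\<lambda>x. scale c (D x)) \<in> T" if "D \<in> T" "D' \<in> T" for D D' c
    using maximal that by (auto simp: maximal_split_torus_def split_torus_def)
  show ?thesis
  proof (rule comm_groupI)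
    fix \<alpha> assume \<alpha>: "\<alpha> \<in> carrier (dual_group T)"
    show "\<exists>\<beta>\<in>carrier (dual_group T). \<beta> \<otimes>\<^bsub>dual_group T\<^esub> \<alpha> = \<one>\<^bsub>dual_group T\<^esub>"
      using \<alpha> closed by (intro bexI[of _ "\<lambda>D\<in>T. - \<alpha> D"]) (auto simp: dual_group_def fun_eq_iff)
  qed (use closed in \<open>auto simp: dual_group_def fun_eq_iff algebra_simps extensional_def\<close>)
qed

text \<open>The weights satisfy the relations as elements of the dual group, so their inclusion into
  it factors through \<open>gen\<close>.\<close>

lemma inj_gen: "inj_on gen \<Omega>"
proof -
  have carr: "(\<lambda>\<alpha>. \<alpha>) ` \<Omega> \<subseteq> carrier (dual_group T)" by (auto simp: weights_def)
  have rel: "\<alpha> \<otimes>\<^bsub>dual_group T\<^esub> \<beta> = \<gamma>" if "(\<alpha>, \<beta>, \<gamma>) \<in> relations" for \<alpha> \<beta> \<gamma>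
    using that by (simp add: relations_def)
  obtain h where "h \<in> hom P (dual_group T)" "\<And>\<alpha>. \<alpha> \<in> \<Omega> \<Longrightarrow> h (gen \<alpha>) = \<alpha>"
    using presented_hom_exists[where f = "\<lambda>\<alpha>. \<alpha>", OF relations_weights dual_comm_group carr rel] by blast
  show ?thesis by (rule inj_on_inverseI) fact
qed

text \<open>The presented group, copied into the type \<open>'u\<close>, carries the universal
  realization. The isomorphism \<iota> is returned as well, so that torsion found in the
  presentation can be moved to a maximal grading.\<close>

lemma maximal_grading_exists:
  obtains U :: "'u::infinite monoid" and V \<iota> where "maximal_grading U V" "\<iota> \<in> iso P U"
    "\<And>\<alpha>. \<alpha> \<in> \<Omega> \<Longrightarrow> V (\<iota> (gen \<alpha>)) = torus_layer T \<alpha>"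
proof -
  interpret P: comm_group P by (rule comm_group_presented[OF relations_weights])
  have "\<exists>\<iota> :: _ \<Rightarrow> 'u. inj_on \<iota> (carrier P)"
  proof -
    obtain \<iota>\<^sub>1 :: "_ \<Rightarrow> nat" where "inj_on \<iota>\<^sub>1 (carrier P)"
      using countable_presented[OF relations_weights finite_weights] by (auto elim: countableE)
    moreover obtain \<iota>\<^sub>2 :: "nat \<Rightarrow> 'u" where "inj \<iota>\<^sub>2"
      using infinite_UNIV[where 'a = 'u] by (auto simp: infinite_iff_countable_subset)
    ultimately have "inj_on (\<iota>\<^sub>2 \<circ> \<iota>\<^sub>1) (carrier P)"
      by (auto intro: comp_inj_on inj_on_subset)
    then show ?thesis by blast
  qed
  then obtain \<iota> :: "_ \<Rightarrow> 'u" where inj: "inj_on \<iota> (carrier P)" by blast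
  define U where "U = image_group \<iota> P"
  have iso: "\<iota> \<in> iso P U" unfolding U_def by (rule inj_imp_image_group_iso[OF inj])
  have "group U" unfolding U_def by (rule P.inj_imp_image_group_is_group[OF inj])
  then have U: "comm_group U"
    by (rule P.iso_imp_comm_group[OF is_isoI[OF iso] group.is_monoid])
  interpret U: comm_group U by (rule U)
  have hom_\<iota>: "\<iota> \<in> hom P U" using iso by (simp add: iso_def)
  define \<kappa> where "\<kappa> = inv_into (carrier P) \<iota>"
  have \<kappa>: "\<kappa> \<in> hom U P"
    using P.iso_set_sym[OF iso] by (simp add: \<kappa>_def iso_def)
  have \<kappa>\<iota>: "\<kappa> (\<iota> p) = p" if "p \<in> carrier P" for p
    using that inj by (simp add: \<kappa>_def)
  have \<iota>_surj: "\<iota> ` carrier P = carrier U" using iso by (auto simp: iso_def bij_betw_def)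
  define c where "c \<alpha> = \<iota> (gen \<alpha>)" for \<alpha>
  note gen_P = presented_gen_carrier[OF relations_weights]
  have c: "inj_on c \<Omega>" "c ` \<Omega> \<subseteq> carrier U"
    using inj_gen gen_P inj \<iota>_surj by (auto simp: c_def inj_on_def)
  have c_rel: "c \<alpha> \<otimes>\<^bsub>U\<^esub> c \<beta> = c \<gamma>" if "(\<alpha>, \<beta>, \<gamma>) \<in> relations" for \<alpha> \<beta> \<gamma>
    using presented_relation[OF relations_weights that] hom_mult[OF hom_\<iota>, of "gen \<alpha>" "gen \<beta>"]
      that relations_weights gen_P by (auto simp: c_def)
  have "universal_realization (dual_group T) (torus_layer T) U (realized_layers c)"
    unfolding universal_realization_def
  proof (intro conjI allI impI)
    show "realization (dual_group T) (torus_layer T) U (realized_layers c)"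
      by (rule realization_realized_layers[OF U c c_rel])
  next
    fix B :: "'u monoid" and W
    assume real: "realization (dual_group T) (torus_layer T) B W"
    then have gr: "grading B W" by (simp add: realization_def)
    then have B: "comm_group B" by (simp add: grading_def)
    interpret B: comm_group B by (rule B)
    obtain f where f: "inj_on f \<Omega>" "f ` \<Omega> \<subseteq> carrier B" "\<forall>\<alpha>\<in>\<Omega>. W (f \<alpha>) = torus_layer T \<alpha>"
      "\<forall>\<beta>\<in>carrier B - f ` \<Omega>. W \<beta> = {0}"
      using real by (auto simp: realization_def)
    have W: "W \<beta> = realized_layers f \<beta>" if "\<beta> \<in> carrier B" for \<beta>
      using that f realized_layers_image[OF f(1)] by (cases "\<beta> \<in> f ` \<Omega>") (auto simp: realized_layers_def)
    \<comment> \<open>The non-zero bracket lies in the layer of \<open>W\<close> at the product of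
      the two indices, by the grading condition, and in the layer at \<open>f \<gamma>\<close>, as a
      vector of the torus layer at \<gamma>. So the two indices agree.\<close>
    have f_rel: "f \<alpha> \<otimes>\<^bsub>B\<^esub> f \<beta> = f \<gamma>" if R: "(\<alpha>, \<beta>, \<gamma>) \<in> relations" for \<alpha> \<beta> \<gamma>
    proof -
      obtain x y where xy: "x \<in> torus_layer T \<alpha>" "y \<in> torus_layer T \<beta>" "bracket x y \<noteq> 0"
        and \<gamma>: "\<gamma> = \<alpha> \<otimes>\<^bsub>dual_group T\<^esub> \<beta>"
        using R by (auto simp: relations_def)
      have \<Omega>: "\<alpha> \<in> \<Omega>" "\<beta> \<in> \<Omega>" "\<gamma> \<in> \<Omega>"
        using R relations_weights by auto
      have carr: "f \<alpha> \<in> carrier B" "f \<beta> \<in> carrier B" "f \<gamma> \<in> carrier B" using f(2) \<Omega> by auto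
      have "bracket x y \<in> W (f \<alpha> \<otimes>\<^bsub>B\<^esub> f \<beta>)"
        using gr carr f(3) \<Omega> xy by (auto simp: grading_def)
      moreover have "bracket x y \<in> W (f \<gamma>)"
        using f(3) \<Omega> bracket_layers[OF xy(1,2)] \<gamma> by simp
      ultimately show ?thesis
        using grading_layers_disjoint[OF gr] carr xy(3) by blast
    qed
    obtain h\<^sub>0 where h\<^sub>0: "h\<^sub>0 \<in> hom P B" "\<And>\<alpha>. \<alpha> \<in> \<Omega> \<Longrightarrow> h\<^sub>0 (gen \<alpha>) = f \<alpha>"
      using presented_hom_exists[OF relations_weights B f(2) f_rel] by blast
    define h where "h = restrict (\<lambda>u. h\<^sub>0 (\<kappa> u)) (carrier U)"
    have h_ext: "h \<in> extensional (carrier U)" by (simp add: h_def)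
    have h_hom: "h \<in> hom U B"
      using hom_compose[OF \<kappa> h\<^sub>0(1)] by (auto simp: hom_def h_def)
    have h_c: "h (c \<alpha>) = f \<alpha>" if "\<alpha> \<in> \<Omega>" for \<alpha>
      using that c(2) h\<^sub>0(2) \<kappa>\<iota>[OF gen_P[OF that]] by (auto simp: h_def c_def)
    show "\<exists>!f. f \<in> hom U B \<inter> extensional (carrier U) \<and>
      (\<forall>\<beta>\<in>carrier B. W \<beta> = push_forward U f (realized_layers c) \<beta>)"
    proof (rule ex1I[of _ h])
      show "h \<in> hom U B \<inter> extensional (carrier U) \<and>
        (\<forall>\<beta>\<in>carrier B. W \<beta> = push_forward U h (realized_layers c) \<beta>)"
        using h_hom W push_forward_realized_layers[OF c f(1) h_c] h_ext by simp
    next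
      fix g assume g: "g \<in> hom U B \<inter> extensional (carrier U) \<and>
        (\<forall>\<beta>\<in>carrier B. W \<beta> = push_forward U g (realized_layers c) \<beta>)"
      have gh: "g \<in> hom U B" using g by simp
      have gW: "W \<beta> = push_forward U g (realized_layers c) \<beta>" if "\<beta> \<in> carrier B" for \<beta>
        using g that by auto
      \<comment> \<open>A non-zero vector of the torus layer at \<alpha> lies in the push-forward
        layer at \<open>g (c \<alpha>)\<close> and in the layer of \<open>W\<close> at
        \<open>f \<alpha>\<close>, which forces the values of \<open>g\<close> on the
        generators.\<close>
      have g_c: "g (c \<alpha>) = f \<alpha>" if \<alpha>: "\<alpha> \<in> \<Omega>" for \<alpha>
      proof -
        have cU: "c \<alpha> \<in> carrier U" using c(2) \<alpha> by blast
        then have gB: "g (c \<alpha>) \<in> carrier B" using hom_in_carrier[OF gh] by simp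
        have \<alpha>B: "f \<alpha> \<in> carrier B" using f(2) \<alpha> by blast
        obtain b where b: "b \<in> torus_layer T \<alpha>" "b \<noteq> 0"
          using \<alpha> subspace_0[OF subspace_layer] by (auto simp: weights_def)
        have "b \<in> realized_layers c (c \<alpha>)"
          using b realized_layers_image[OF c(1) \<alpha>] by simp
        then have "b \<in> push_forward U g (realized_layers c) (g (c \<alpha>))"
          unfolding push_forward_def sum_of_layers_def using cU by (intro span_base) auto
        then have "b \<in> W (g (c \<alpha>))" using gW[OF gB] by simp
        moreover have "b \<in> W (f \<alpha>)" using f(3) \<alpha> b(1) by simp
        ultimately show ?thesis using grading_layers_disjoint[OF gr gB \<alpha>B] b(2) by blast
      qed
      have "g u = h u" if u: "u \<in> carrier U" for u
      proof -
        obtain p where p: "p \<in> carrier P" "u = \<iota> p" using u \<iota>_surj by blast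
        have "(\<lambda>p. g (\<iota> p)) \<in> hom P B" "(\<lambda>p. h (\<iota> p)) \<in> hom P B"
          using hom_compose[OF hom_\<iota>, of g B] hom_compose[OF hom_\<iota>, of h B] g h_hom by (auto simp: comp_def)
        from presented_hom_unique[OF relations_weights B.is_group this] show ?thesis
          using p g_c h_c by (simp add: c_def)
      qed
      moreover have "g \<in> extensional (carrier U)" "h \<in> extensional (carrier U)"
        using g h_ext by auto
      ultimately show "g = h" by (intro extensionalityI) auto
    qed
  qed
  then have "maximal_grading U (realized_layers c)"
    unfolding maximal_grading_def using maximal by blast
  then show thesis
    using that[OF _ iso] realized_layers_image[OF c(1)] by (simp add: c_def)
qed

lemma invariant_vector_weight:
  assumes x: "x \<noteq> 0" "\<forall>D\<in>T. D x = 0"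
  shows "x \<in> torus_layer T \<one>\<^bsub>dual_group T\<^esub>" "\<one>\<^bsub>dual_group T\<^esub> \<in> \<Omega>"
proof -
  have one: "\<one>\<^bsub>dual_group T\<^esub> = (\<lambda>D\<in>T. 0)" by (simp add: dual_group_def)
  show x0: "x \<in> torus_layer T \<one>\<^bsub>dual_group T\<^esub>"
    unfolding one using x by (simp add: torus_layer_def)
  show "\<one>\<^bsub>dual_group T\<^esub> \<in> \<Omega>"
    unfolding weights_eq by (rule nonzero_layer_weight[OF x0 _ x(1)]) (simp add: one)
qed

text \<open>Scaling the layer at \<alpha> by \<open>f \<alpha>\<close> is a derivation, because
  \<open>f\<close> is additive wherever a bracket is non-zero. It is diagonal on \<open>E\<close>,
  so maximality puts it into \<open>T\<close> and it kills \<open>x\<close>, which lies in the layer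
  of weight zero. In characteristic zero the rational scalar there must vanish.\<close>

lemma additive_weight_function_zero:
  fixes f :: "(('a \<Rightarrow> 'a) \<Rightarrow> 'k) \<Rightarrow> rat"
  assumes rel: "\<And>\<alpha> \<beta> \<gamma>. (\<alpha>, \<beta>, \<gamma>) \<in> relations \<Longrightarrow> f \<alpha> + f \<beta> = f \<gamma>"
    and x: "x \<noteq> 0" "\<forall>D\<in>T. D x = 0"
  shows "f \<one>\<^bsub>dual_group T\<^esub> = 0"
proof -
  define \<delta> where "\<delta> x = (\<Sum>\<alpha>\<in>\<Omega>. scale (of_rat (f \<alpha>)) (layer_proj \<alpha> x))" for x
  have lin_\<delta>: "lin \<delta>"
    by (rule linI) (simp_all add: \<delta>_def lin_simps[OF lin_layer_proj] scale_right_distrib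
        sum.distrib scale_sum_right mult.commute)
  have layer: "\<delta> y = scale (of_rat (f \<alpha>)) y" if "y \<in> torus_layer T \<alpha>" "\<alpha> \<in> \<Omega>" for y \<alpha>
  proof -
    have "\<delta> y = (\<Sum>\<beta>\<in>\<Omega>. if \<beta> = \<alpha> then scale (of_rat (f \<alpha>)) y else 0)"
      unfolding \<delta>_def using layer_proj_id[OF that(1)] layer_proj_other[OF that(1)] weights_extensional[OF that(2)]
      by (intro sum.cong) auto
    then show ?thesis using that(2) by (simp add: finite_weights)
  qed
  have layers: "\<delta> (bracket y z) = bracket (\<delta> y) z + bracket y (\<delta> z)"
    if yz: "y \<in> torus_layer T \<alpha>" "\<alpha> \<in> \<Omega>" "z \<in> torus_layer T \<beta>" "\<beta> \<in> \<Omega>" for y z \<alpha> \<beta>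
  proof (cases "bracket y z = 0")
    case True
    then show ?thesis
      using layer[OF yz(1,2)] layer[OF yz(3,4)]
      by (simp add: bracket_scale_left bracket_scale_right lin_simps[OF lin_\<delta>])
  next
    case False
    then have R: "(\<alpha>, \<beta>, \<alpha> \<otimes>\<^bsub>dual_group T\<^esub> \<beta>) \<in> relations"
      using yz by (auto simp: relations_def)
    then have "\<alpha> \<otimes>\<^bsub>dual_group T\<^esub> \<beta> \<in> \<Omega>" using relations_weights by blast
    from layer[OF bracket_layers[OF yz(1,3)] this] show ?thesis
      using layer[OF yz(1,2)] layer[OF yz(3,4)] rel[OF R, symmetric]
      by (simp add: bracket_scale_left bracket_scale_right of_rat_add scale_left_distrib)
  qed
  have "\<delta> (bracket y z) = bracket (\<delta> y) z + bracket y (\<delta> z)" for y z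
  proof -
    let ?y = "\<Sum>\<alpha>\<in>\<Omega>. layer_proj \<alpha> y" and ?z = "\<Sum>\<beta>\<in>\<Omega>. layer_proj \<beta> z"
    have "\<delta> (bracket ?y ?z) = bracket (\<delta> ?y) ?z + bracket ?y (\<delta> ?z)"
      unfolding bracket_sum_left bracket_sum_right lin_simps(6)[OF lin_\<delta>] sum.distrib[symmetric]
      by (intro sum.cong refl layers[OF layer_proj_in _ layer_proj_in])
    then show ?thesis by (simp only: weights_eq sum_layer_proj)
  qed
  then have "\<delta> \<in> derivations"
    using lin_\<delta> by (simp add: derivations_def)
  moreover have "\<exists>c. \<delta> b = scale c b" if "b \<in> E" for b
    using layer[OF basis_in_layer[OF that]] that by (auto simp: weights_eq)
  ultimately have "\<delta> \<in> diagonal_derivations E" by (simp add: diagonal_derivations_def)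
  then have "\<delta> \<in> T"
    using maximal_split_torus_diagonal[where E = E, OF maximal span_E] eigen_E by blast
  then have "\<delta> x = 0" using x by blast
  from layer[OF invariant_vector_weight[OF x]] show ?thesis using \<open>\<delta> x = 0\<close> x(1) by simp
qed

text \<open>The zero of the dual group is a weight here, but its generator in the presented group
  need not be trivial: only finite order follows. Its image in \<open>U\<close> is the identity or a
  non-trivial torsion element, hence the alternative.\<close>

lemma invariant_vector_torsion_weight:
  assumes x: "x \<noteq> 0" "\<forall>D\<in>T. D x = 0"
  obtains U :: "'u::infinite monoid" and V where "maximal_grading U V"
    "\<one>\<^bsub>U\<^esub> \<in> weights U V \<or> \<not> no_nonzero_torsion_weight U V"
proof -
  let ?o = "\<one>\<^bsub>dual_group T\<^esub>"
  interpret P: comm_group P by (rule comm_group_presented[OF relations_weights])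
  note x0 = invariant_vector_weight(1)[OF x] and o = invariant_vector_weight(2)[OF x]
  obtain n :: nat where n: "n > 0" "gen ?o [^]\<^bsub>P\<^esub> n = \<one>\<^bsub>P\<^esub>"
    using presented_torsion[OF relations_weights o] additive_weight_function_zero[OF _ x] by blast
  obtain U :: "'u monoid" and V \<iota> where U: "maximal_grading U V" "\<iota> \<in> iso P U"
    "\<And>\<alpha>. \<alpha> \<in> \<Omega> \<Longrightarrow> V (\<iota> (gen \<alpha>)) = torus_layer T \<alpha>"
    using maximal_grading_exists by blast
  have "grading U V"
    using U(1) by (auto simp: maximal_grading_def universal_realization_def realization_def)
  then interpret U: comm_group U by (simp add: grading_def)
  interpret \<iota>: group_hom P U \<iota>
    using U(2) by unfold_locales (simp add: iso_def)
  let ?w = "\<iota> (gen ?o)"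
  have genP: "gen ?o \<in> carrier P" by (rule presented_gen_carrier[OF relations_weights o])
  have "?w \<in> weights U V"
    using U(3)[OF o] x0 x(1) genP by (auto simp: weights_def)
  moreover have "?w [^]\<^bsub>U\<^esub> n = \<one>\<^bsub>U\<^esub>"
    using \<iota>.hom_nat_pow[OF genP, of n] n(2) by simp
  ultimately have "\<one>\<^bsub>U\<^esub> \<in> weights U V \<or> \<not> no_nonzero_torsion_weight U V"
    unfolding no_nonzero_torsion_weight_def using n(1) by metis
  with U(1) show thesis by (rule that)
qed

end

section \<open>Direct products\<close>

context fd_lie_algebra
begin

lemma split_torus_subset:
  assumes "split_torus S" "T \<subseteq> S" "(\<lambda>x. 0) \<in> T"
    "\<And>D D'. D \<in> T \<Longrightarrow> D' \<in> T \<Longrightarrow> (\<lambda>x. D x + D' x) \<in> T"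
    "\<And>c D. D \<in> T \<Longrightarrow> (\<lambda>x. scale c (D x)) \<in> T"
  shows "split_torus T"
  unfolding split_torus_def
proof (intro conjI)
  show "T \<subseteq> derivations" using assms(1,2) by (auto simp: split_torus_def)
  show "\<forall>\<delta>\<in>T. \<forall>\<epsilon>\<in>T. \<forall>x. \<delta> (\<epsilon> x) - \<epsilon> (\<delta> x) = 0"
    using assms(1,2) unfolding split_torus_def by blast
  obtain E where "independent E" "span E = UNIV" "\<forall>e\<in>E. \<forall>\<delta>\<in>S. \<exists>c. \<delta> e = scale c e"
    using assms(1) unfolding split_torus_def by blast
  then show "\<exists>E. independent E \<and> span E = UNIV \<and> (\<forall>e\<in>E. \<forall>\<delta>\<in>T. \<exists>c. \<delta> e = scale c e)"
    using assms(2) by (intro exI[of _ E]) blast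
qed (use assms in auto)

end

lemma linear_facts:
  assumes "Vector_Spaces.linear s1 s2 f"
  shows "f (x + y) = f x + f y" "f (s1 c x) = s2 c (f x)" "f 0 = 0" "f (x - y) = f x - f y"
    "f (sum g S) = (\<Sum>i\<in>S. f (g i))"
proof -
  interpret module_hom s1 s2 f using assms by (simp add: module_hom_iff_linear)
  show "f (x + y) = f x + f y" "f (s1 c x) = s2 c (f x)" "f 0 = 0" "f (x - y) = f x - f y"
    "f (sum g S) = (\<Sum>i\<in>S. f (g i))"
    by (simp_all add: add scale diff sum)
qed

text \<open>The product is given by inclusions and projections rather than by a product type, so
  that the factors can be images under \<Phi> and the two roles can be exchanged by
  \<open>flip\<close>.\<close>

locale lie_product =
  g: fd_lie_algebra s b Bs + g1: fd_lie_algebra s1 b1 Bs1 + g2: fd_lie_algebra s2 b2 Bs2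
  for s :: "'k::field_char_0 \<Rightarrow> 'a::ab_group_add \<Rightarrow> 'a" and b Bs
    and s1 :: "'k \<Rightarrow> 'b::ab_group_add \<Rightarrow> 'b" and b1 Bs1
    and s2 :: "'k \<Rightarrow> 'c::ab_group_add \<Rightarrow> 'c" and b2 Bs2 +
  fixes i1 :: "'b \<Rightarrow> 'a" and p1 :: "'a \<Rightarrow> 'b" and i2 :: "'c \<Rightarrow> 'a" and p2 :: "'a \<Rightarrow> 'c"
  assumes lin_i1: "Vector_Spaces.linear s1 s i1" and lin_p1: "Vector_Spaces.linear s s1 p1"
    and lin_i2: "Vector_Spaces.linear s2 s i2" and lin_p2: "Vector_Spaces.linear s s2 p2"
    and p1_hom: "p1 (b x y) = b1 (p1 x) (p1 y)" and p2_hom: "p2 (b x y) = b2 (p2 x) (p2 y)"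
    and p1_i1 [simp]: "p1 (i1 u) = u" and p2_i2 [simp]: "p2 (i2 w) = w"
    and p1_i2 [simp]: "p1 (i2 w) = 0" and p2_i1 [simp]: "p2 (i1 u) = 0"
    and decomposition: "i1 (p1 z) + i2 (p2 z) = z"
begin

lemma flip: "lie_product s b Bs s2 b2 Bs2 s1 b1 Bs1 i2 p2 i1 p1"
  by (intro lie_product.intro lie_product_axioms.intro g.fd_lie_algebra_axioms g1.fd_lie_algebra_axioms
      g2.fd_lie_algebra_axioms lin_i1 lin_i2 lin_p1 lin_p2 p1_hom p2_hom p1_i1 p2_i2 p1_i2 p2_i1)
    (use decomposition in \<open>simp add: add.commute\<close>)

lemmas i1_simps = linear_facts[OF lin_i1] and i2_simps = linear_facts[OF lin_i2]
  and p1_simps = linear_facts[OF lin_p1] and p2_simps = linear_facts[OF lin_p2]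

lemma eq_i1: "p2 z = 0 \<Longrightarrow> i1 (p1 z) = z"
  using decomposition[of z] by (simp add: i2_simps)

lemma i1_eq_0 [simp]: "i1 u = 0 \<longleftrightarrow> u = 0"
  by (metis p1_i1 i1_simps(3))

lemma bracket_i1_left: "b (i1 u) z = i1 (b1 u (p1 z))"
  using eq_i1[of "b (i1 u) z"] by (simp add: p1_hom p2_hom)

lemma bracket_i1_right: "b z (i1 u) = i1 (b1 (p1 z) u)"
  using eq_i1[of "b z (i1 u)"] by (simp add: p1_hom p2_hom)

lemma lift_derivation:
  assumes "D \<in> g1.derivations" shows "(\<lambda>z. i1 (D (p1 z))) \<in> g.derivations"
proof -
  note D = g1.derivationD[OF assms]
  have "g.lin (\<lambda>z. i1 (D (p1 z)))"
    by (rule g.linI) (simp_all add: i1_simps p1_simps linear_facts[OF D(1)])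
  then show ?thesis
    by (simp add: g.derivations_def p1_hom D(2) i1_simps bracket_i1_left bracket_i1_right)
qed

lemma restrict_derivation:
  assumes "D \<in> g.derivations" shows "(\<lambda>x. p1 (D (i1 x))) \<in> g1.derivations"
proof -
  note D = g.derivationD[OF assms]
  have "g1.lin (\<lambda>x. p1 (D (i1 x)))"
    by (rule g1.linI) (simp_all add: i1_simps p1_simps linear_facts[OF D(1)])
  moreover have "p1 (D (i1 (b1 x y))) = b1 (p1 (D (i1 x))) y + b1 x (p1 (D (i1 y)))" for x y
  proof -
    have "i1 (b1 x y) = b (i1 x) (i1 y)" by (simp add: bracket_i1_left)
    then show ?thesis by (simp add: D(2) p1_simps p1_hom)
  qed
  ultimately show ?thesis by (simp add: g1.derivations_def)
qed

lemma subspace_range_i1: "g.subspace (range i1)"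
  by (rule g.subspaceI) (auto simp: image_iff simp flip: i1_simps)

definition factor_torus :: "('a \<Rightarrow> 'a) set \<Rightarrow> ('b \<Rightarrow> 'b) set"
  where "factor_torus T = (\<lambda>D x. p1 (D (i1 x))) ` T"

section \<open>Tori that commute with the projections, and the tori they induce on a factor\<close>

context
  fixes T
  assumes T: "g.maximal_split_torus T"
    and invariant: "\<And>D z. D \<in> T \<Longrightarrow> D (i1 (p1 z)) = i1 (p1 (D z))"
begin

lemma torus: "g.split_torus T"
  using T by (simp add: g.maximal_split_torus_def)

lemma torus_derivation: "D \<in> T \<Longrightarrow> D \<in> g.derivations"
  using torus by (auto simp: g.split_torus_def)

lemma torus_eigenbasis:
  obtains E where "g.span E = UNIV" "\<And>e D. e \<in> E \<Longrightarrow> D \<in> T \<Longrightarrow> \<exists>c. D e = s c e"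
  using torus unfolding g.split_torus_def by blast

lemma apply_i1: "D \<in> T \<Longrightarrow> D (i1 x) = i1 (p1 (D (i1 x)))"
  using invariant[of D "i1 x"] by simp

text \<open>Extended by zero to the second factor, a derivation in \<open>S\<close> is diagonal on a
  spanning set of eigenvectors of \<open>T\<close>, so maximality puts it into \<open>T\<close>. An
  arbitrary \<open>S\<close> gives the maximality of the factor torus; the choice
  \<open>S = factor_torus T\<close> shows that \<open>T\<close> contains the extended factor
  torus.\<close>

lemma lift_in_torus:
  assumes S: "g1.split_torus S" "factor_torus T \<subseteq> S" and D: "D \<in> S"
  shows "(\<lambda>z. i1 (D (p1 z))) \<in> T"
proof -
  obtain E where E: "g.span E = UNIV" "\<And>e D. e \<in> E \<Longrightarrow> D \<in> T \<Longrightarrow> \<exists>c. D e = s c e"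
    using torus_eigenbasis by blast
  obtain E1 where E1: "g1.span E1 = UNIV" "\<forall>e\<in>E1. \<forall>D\<in>S. \<exists>c. D e = s1 c e"
    using S(1) unfolding g1.split_torus_def by blast
  \<comment> \<open>Spanning eigenvectors of \<open>S\<close> in the first factor, together with the
    second components of eigenvectors of \<open>T\<close>. The latter are eigenvectors of
    \<open>T\<close> again because the projections commute with \<open>T\<close>.\<close>
  let ?E = "i1 ` E1 \<union> (i2 \<circ> p2) ` E"
  interpret i1: module_hom s1 s i1 using lin_i1 by (simp add: module_hom_iff_linear)
  have lin_i2p2: "g.lin (i2 \<circ> p2)"
    by (rule g.linI) (simp_all add: i2_simps p2_simps)
  interpret i2p2: module_hom s s "i2 \<circ> p2" using lin_i2p2 by (simp add: module_hom_iff_linear)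
  have span: "g.span ?E = UNIV"
  proof -
    have "i1 (p1 z) \<in> g.span (i1 ` E1)" for z
      using i1.span_image[of E1] E1(1) by auto
    moreover have "i2 (p2 z) \<in> g.span ((i2 \<circ> p2) ` E)" for z
      using i2p2.span_image[of E] E(1) by auto
    ultimately have "i1 (p1 z) + i2 (p2 z) \<in> g.span ?E" for z
      using g.span_mono[of "i1 ` E1" ?E] g.span_mono[of "(i2 \<circ> p2) ` E" ?E]
      by (intro g.span_add) blast+
    then show ?thesis by (auto simp: decomposition)
  qed
  have eigen: "\<exists>c. D' e = s c e" if e: "e \<in> ?E" and D': "D' \<in> T" for e D'
  proof (cases "e \<in> i1 ` E1")
    case True
    then obtain e1 where e1: "e1 \<in> E1" "e = i1 e1" by blast
    have "(\<lambda>x. p1 (D' (i1 x))) \<in> S" using S(2) D' by (auto simp: factor_torus_def)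
    from bspec[OF bspec[OF E1(2) e1(1)] this] have "\<exists>c. p1 (D' (i1 e1)) = s1 c e1" .
    then obtain c where "p1 (D' (i1 e1)) = s1 c e1" ..
    then have "D' e = s c e"
      using apply_i1[OF D', of e1] by (simp add: e1(2) i1_simps)
    then show ?thesis ..
  next
    case False
    then obtain e0 where e0: "e0 \<in> E" "e = i2 (p2 e0)" using e by auto
    then have e_eq: "e = e0 - i1 (p1 e0)" using decomposition[of e0] by (simp add: eq_diff_eq add.commute)
    obtain c where c: "D' e0 = s c e0" using E(2)[OF e0(1) D'] by blast
    have "D' e = s c e"
      unfolding e_eq
      by (simp add: linear_facts[OF g.derivationD(1)[OF torus_derivation[OF D']]] invariant[OF D'] c
          p1_simps i1_simps g.scale_right_diff_distrib)
    then show ?thesis ..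
  qed
  have "T = g.diagonal_derivations ?E"
    using g.maximal_split_torus_diagonal[OF T span] eigen by blast
  moreover have "(\<lambda>z. i1 (D (p1 z))) \<in> g.diagonal_derivations ?E"
  proof -
    have der: "D \<in> g1.derivations" using S(1) D by (auto simp: g1.split_torus_def)
    have "\<exists>c. i1 (D (p1 e)) = s c e" if e: "e \<in> ?E" for e
    proof (cases "e \<in> i1 ` E1")
      case True
      then obtain e1 where e1: "e1 \<in> E1" "e = i1 e1" by blast
      then obtain c where "D e1 = s1 c e1" using E1(2) D by blast
      then show ?thesis using e1(2) by (auto simp: i1_simps)
    next
      case False
      then obtain e0 where "e = i2 (p2 e0)" using e by auto
      then have "i1 (D (p1 e)) = s 0 e"
        by (simp add: linear_facts[OF g1.derivationD(1)[OF der]] i1_simps)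
      then show ?thesis ..
    qed
    then show ?thesis
      using lift_derivation[OF der] by (simp add: g.diagonal_derivations_def)
  qed
  ultimately show ?thesis by simp
qed

lemma split_factor_torus: "g1.split_torus (factor_torus T)"
proof -
  obtain E where E: "g.span E = UNIV" "\<And>e D. e \<in> E \<Longrightarrow> D \<in> T \<Longrightarrow> \<exists>c. D e = s c e"
    using torus_eigenbasis by blast
  interpret p1: module_hom s s1 p1 using lin_p1 by (simp add: module_hom_iff_linear)
  have span: "g1.span (p1 ` E) = UNIV"
  proof -
    have "range p1 = UNIV" by (metis p1_i1 surjI)
    then show ?thesis using p1.span_image[of E] E(1) by simp
  qed
  show ?thesis
  proof (rule g1.split_torus_subset[OF g1.split_torus_diagonal[OF span]])
    show "factor_torus T \<subseteq> g1.diagonal_derivations (p1 ` E)"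
    proof
      fix D1 assume "D1 \<in> factor_torus T"
      then obtain D where D: "D \<in> T" "D1 = (\<lambda>x. p1 (D (i1 x)))"
        by (auto simp: factor_torus_def)
      have "\<exists>c. D1 (p1 e) = s1 c (p1 e)" if e: "e \<in> E" for e
      proof -
        obtain c where "D e = s c e" using E(2)[OF e D(1)] by blast
        then have "D1 (p1 e) = s1 c (p1 e)"
          by (simp add: D(2) invariant[OF D(1)] p1_simps)
        then show ?thesis ..
      qed
      then show "D1 \<in> g1.diagonal_derivations (p1 ` E)"
        using restrict_derivation[OF torus_derivation[OF D(1)]] D(2)
        by (auto simp: g1.diagonal_derivations_def)
    qed
    have "(\<lambda>x. 0) \<in> T" using torus by (simp add: g.split_torus_def)
    then show "(\<lambda>x. 0) \<in> factor_torus T"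
      unfolding factor_torus_def by (rule rev_image_eqI) (simp add: p1_simps)
    show "(\<lambda>x. D x + D' x) \<in> factor_torus T" if D: "D \<in> factor_torus T" "D' \<in> factor_torus T" for D D'
    proof -
      obtain C C' where C: "C \<in> T" "D = (\<lambda>x. p1 (C (i1 x)))" "C' \<in> T" "D' = (\<lambda>x. p1 (C' (i1 x)))"
        using D unfolding factor_torus_def by blast
      then have "(\<lambda>x. C x + C' x) \<in> T" using torus by (simp add: g.split_torus_def)
      then show ?thesis
        unfolding factor_torus_def by (rule rev_image_eqI) (simp add: C p1_simps)
    qed
    show "(\<lambda>x. s1 c (D x)) \<in> factor_torus T" if D: "D \<in> factor_torus T" for c D
    proof -
      obtain C where C: "C \<in> T" "D = (\<lambda>x. p1 (C (i1 x)))"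
        using D unfolding factor_torus_def by blast
      then have "(\<lambda>x. s c (C x)) \<in> T" using torus by (simp add: g.split_torus_def)
      then show ?thesis
        unfolding factor_torus_def by (rule rev_image_eqI) (simp add: C p1_simps)
    qed
  qed
qed

lemma maximal_factor_torus: "g1.maximal_split_torus (factor_torus T)"
  unfolding g1.maximal_split_torus_def
proof (intro conjI allI impI split_factor_torus)
  fix S assume S: "g1.split_torus S" "factor_torus T \<subseteq> S"
  have "S \<subseteq> factor_torus T"
  proof
    fix D assume "D \<in> S"
    from lift_in_torus[OF S this] show "D \<in> factor_torus T"
      unfolding factor_torus_def by (rule rev_image_eqI) simp
  qed
  with S(2) show "S = factor_torus T" by blast
qed

text \<open>An element of the factor torus, extended by zero, acts on \<open>v\<close> by a scalar
  and kills its second component. As \<open>p2 v\<close> is non-zero the scalar is zero, so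
  \<open>p1 v\<close> is killed by the whole factor torus.\<close>

lemma mixed_vector_torsion_weight:
  assumes v: "v \<in> g.torus_layer T \<gamma>" "p1 v \<noteq> 0" "p2 v \<noteq> 0"
  obtains U :: "'u::infinite monoid" and V where "g1.maximal_grading U V"
    "\<one>\<^bsub>U\<^esub> \<in> g1.weights U V \<or> \<not> g1.no_nonzero_torsion_weight U V"
proof -
  have inv: "\<forall>D\<in>factor_torus T. D (p1 v) = 0"
  proof
    fix D assume "D \<in> factor_torus T"
    then have L: "(\<lambda>z. i1 (D (p1 z))) \<in> T"
      by (rule lift_in_torus[OF split_factor_torus order_refl])
    then have eq: "i1 (D (p1 v)) = s (\<gamma> (\<lambda>z. i1 (D (p1 z)))) v"
      using v(1) by (auto simp: g.torus_layer_def)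
    then have "p2 (s (\<gamma> (\<lambda>z. i1 (D (p1 z)))) v) = 0" by (metis p2_i1)
    then have "\<gamma> (\<lambda>z. i1 (D (p1 z))) = 0" using v(3) by (simp add: p2_simps)
    then show "D (p1 v) = 0" using eq by simp
  qed
  obtain E where "torus_family s1 b1 Bs1 (factor_torus T) E"
    using g1.split_torus_basis[OF split_factor_torus] by blast
  then interpret m: maximal_torus_family s1 b1 Bs1 "factor_torus T" E
    by (rule maximal_torus_family.intro) (rule maximal_torus_family_axioms.intro[OF maximal_factor_torus])
  show thesis
    using m.invariant_vector_torsion_weight[OF v(2) inv] that by blast
qed

end

section \<open>Gradings in which every homogeneous vector lies in one of the two factors\<close>

context
  fixes A :: "'u monoid" and V
  assumes grading: "g.grading A V"
    and unmixed: "\<forall>\<alpha>\<in>carrier A. \<forall>v\<in>V \<alpha>. p1 v = 0 \<or> p2 v = 0"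
begin

definition factor_weights :: "'u set"
  where "factor_weights = {\<alpha> \<in> g.weights A V. \<forall>v\<in>V \<alpha>. p2 v = 0}"

definition cofactor_weights :: "'u set"
  where "cofactor_weights = {\<alpha> \<in> g.weights A V. \<forall>v\<in>V \<alpha>. p1 v = 0}"

lemma subspace_layers: "\<alpha> \<in> carrier A \<Longrightarrow> g.subspace (V \<alpha>)"
  using grading by (simp add: g.grading_def g.direct_sum_of_def)

text \<open>A subspace is not the union of two proper subspaces: if a layer had a vector outside the
  first factor and one outside the second, their sum would be mixed.\<close>

lemma weights_union: "g.weights A V = factor_weights \<union> cofactor_weights"
proof -
  have "\<alpha> \<in> factor_weights \<or> \<alpha> \<in> cofactor_weights" if \<alpha>: "\<alpha> \<in> g.weights A V" for \<alpha>
  proof (rule ccontr)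
    assume "\<not> (\<alpha> \<in> factor_weights \<or> \<alpha> \<in> cofactor_weights)"
    then obtain v w where vw: "v \<in> V \<alpha>" "p2 v \<noteq> 0" "w \<in> V \<alpha>" "p1 w \<noteq> 0"
      using \<alpha> by (auto simp: factor_weights_def cofactor_weights_def)
    have A: "\<alpha> \<in> carrier A" using \<alpha> by (simp add: g.weights_def)
    have "v + w \<in> V \<alpha>" using g.subspace_add[OF subspace_layers[OF A]] vw by blast
    moreover have "p1 v = 0" "p2 w = 0" using unmixed A vw by blast+
    moreover have "p1 (v + w) = 0 \<or> p2 (v + w) = 0"
      using unmixed A \<open>v + w \<in> V \<alpha>\<close> by blast
    ultimately show False using vw by (simp add: p1_simps p2_simps)
  qed
  then show ?thesis by (auto simp: factor_weights_def cofactor_weights_def)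
qed

lemma weights_disjoint: "factor_weights \<inter> cofactor_weights = {}"
proof -
  have False if \<alpha>: "\<alpha> \<in> factor_weights" "\<alpha> \<in> cofactor_weights" for \<alpha>
  proof -
    have A: "\<alpha> \<in> carrier A" "V \<alpha> \<noteq> {0}" using \<alpha> by (auto simp: factor_weights_def g.weights_def)
    have "v = 0" if "v \<in> V \<alpha>" for v
      using \<alpha> that decomposition[of v]
      by (simp add: factor_weights_def cofactor_weights_def i1_simps i2_simps)
    then show False using A g.subspace_0[OF subspace_layers[OF A(1)]] by blast
  qed
  then show ?thesis by blast
qed

text \<open>A vector of the first factor is unchanged by the projection to that factor. Applied to
  its homogeneous components, the projection fixes those in layers of the first kind and kills the
  others.\<close>

lemma sum_of_factor_layers: "g.sum_of_layers V factor_weights = range i1"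
proof
  show "g.sum_of_layers V factor_weights \<subseteq> range i1"
    unfolding g.sum_of_layers_def
  proof (rule g.span_minimal[OF _ subspace_range_i1], rule UN_least, rule subsetI)
    fix \<alpha> v assume "\<alpha> \<in> factor_weights" "v \<in> V \<alpha>"
    then have "v = i1 (p1 v)" by (simp add: factor_weights_def eq_i1)
    then show "v \<in> range i1" by (rule range_eqI)
  qed
  show "range i1 \<subseteq> g.sum_of_layers V factor_weights"
  proof (rule image_subsetI)
    fix x
    obtain f where f: "\<forall>i\<in>carrier A. f i \<in> V i" "\<forall>i. i \<notin> carrier A \<longrightarrow> f i = 0"
      "i1 x = (\<Sum>i | f i \<noteq> 0. f i)"
      using grading unfolding g.grading_def g.direct_sum_of_def by metis
    have "i1 x = i1 (p1 (i1 x))" by simp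
    also have "\<dots> = (\<Sum>i | f i \<noteq> 0. i1 (p1 (f i)))" by (simp only: f(3) p1_simps i1_simps)
    also have "\<dots> \<in> g.sum_of_layers V factor_weights"
      unfolding g.sum_of_layers_def
    proof (rule g.span_sum)
      fix i assume "i \<in> {i. f i \<noteq> 0}"
      then have i: "i \<in> carrier A" "f i \<in> V i" "f i \<noteq> 0" using f(1,2) by auto
      then have "i \<in> g.weights A V" by (auto simp: g.weights_def)
      then consider "i \<in> factor_weights" | "i \<in> cofactor_weights" using weights_union by blast
      then show "i1 (p1 (f i)) \<in> g.span (\<Union> (V ` factor_weights))"
      proof cases
        case 1
        then have "i1 (p1 (f i)) = f i" using i(2) by (simp add: factor_weights_def eq_i1)
        then show ?thesis using 1 i(2) by (auto intro: g.span_base)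
      next
        case 2
        then have "p1 (f i) = 0" using i(2) by (simp add: cofactor_weights_def)
        then show ?thesis using g.span_zero by (simp add: i1_simps)
      qed
    qed
    finally show "i1 x \<in> g.sum_of_layers V factor_weights" .
  qed
qed

end

lemma ideal_range_i1: "g.lie_ideal (range i1)"
  using subspace_range_i1 by (auto simp: g.lie_ideal_def bracket_i1_right)

lemma isomorphic_range_i1: "lie_isomorphic_to_ideal s1 b1 s b (range i1)"
proof -
  have "i1 (b1 x y) = b (i1 x) (i1 y)" for x y by (simp add: bracket_i1_left)
  moreover have "inj i1" by (rule inj_on_inverseI[of _ p1]) simp
  ultimately show ?thesis
    unfolding lie_isomorphic_to_ideal_def using lin_i1 by (auto simp: bij_betw_def)
qed

lemma product_detected:
  assumes grading: "g.grading A V"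
    and unmixed: "\<forall>\<alpha>\<in>carrier A. \<forall>v\<in>V \<alpha>. p1 v = 0 \<or> p2 v = 0"
  shows "\<exists>\<Omega>\<^sub>1 \<Omega>\<^sub>2.
    g.weights A V = \<Omega>\<^sub>1 \<union> \<Omega>\<^sub>2 \<and> \<Omega>\<^sub>1 \<inter> \<Omega>\<^sub>2 = {} \<and>
    (\<forall>\<alpha>\<in>\<Omega>\<^sub>1. \<forall>\<beta>\<in>\<Omega>\<^sub>2. {\<alpha>, \<beta>} \<notin> g.edges A V) \<and>
    g.direct_product_of_ideals (g.sum_of_layers V \<Omega>\<^sub>1) (g.sum_of_layers V \<Omega>\<^sub>2) \<and>
    lie_isomorphic_to_ideal s1 b1 s b (g.sum_of_layers V \<Omega>\<^sub>1) \<and>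
    lie_isomorphic_to_ideal s2 b2 s b (g.sum_of_layers V \<Omega>\<^sub>2)"
proof -
  interpret f: lie_product s b Bs s2 b2 Bs2 s1 b1 Bs1 i2 p2 i1 p1 by (rule flip)
  have unmixed': "\<forall>\<alpha>\<in>carrier A. \<forall>v\<in>V \<alpha>. p2 v = 0 \<or> p1 v = 0"
    using unmixed by blast
  let ?\<Omega>1 = "factor_weights A V" and ?\<Omega>2 = "f.factor_weights A V"
  have \<Omega>2: "?\<Omega>2 = cofactor_weights A V"
    by (simp add: f.factor_weights_def[OF grading unmixed'] cofactor_weights_def[OF grading unmixed])
  have union: "g.weights A V = ?\<Omega>1 \<union> ?\<Omega>2" and disjoint: "?\<Omega>1 \<inter> ?\<Omega>2 = {}"
    unfolding \<Omega>2 using weights_union[OF grading unmixed] weights_disjoint[OF grading unmixed] by blast+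
  have sum1: "g.sum_of_layers V ?\<Omega>1 = range i1" and sum2: "g.sum_of_layers V ?\<Omega>2 = range i2"
    by (rule sum_of_factor_layers[OF grading unmixed] f.sum_of_factor_layers[OF grading unmixed']; assumption)+
  have in1: "v \<in> range i1" if "\<alpha> \<in> ?\<Omega>1" "v \<in> V \<alpha>" for \<alpha> v
    using that sum1 g.span_base[of v "\<Union> (V ` ?\<Omega>1)"] by (auto simp: g.sum_of_layers_def)
  have in2: "v \<in> range i2" if "\<alpha> \<in> ?\<Omega>2" "v \<in> V \<alpha>" for \<alpha> v
    using that sum2 g.span_base[of v "\<Union> (V ` ?\<Omega>2)"] by (auto simp: g.sum_of_layers_def)
  \<comment> \<open>A non-zero bracket cannot come from layers in different factors, and a bracket
    of two vectors of one factor stays in it. So the vertices \<mu>, \<nu> and their product all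
    belong to the same part.\<close>
  have no_edge: "{\<alpha>, \<beta>} \<notin> g.edges A V" if \<alpha>\<beta>: "\<alpha> \<in> ?\<Omega>1" "\<beta> \<in> ?\<Omega>2" for \<alpha> \<beta>
  proof
    assume "{\<alpha>, \<beta>} \<in> g.edges A V"
    then obtain \<mu> \<nu> x y where \<mu>\<nu>: "\<mu> \<in> g.weights A V" "\<nu> \<in> g.weights A V" "x \<in> V \<mu>" "y \<in> V \<nu>"
      "b x y \<noteq> 0" and sub: "{\<alpha>, \<beta>} \<subseteq> {\<mu>, \<nu>, \<mu> \<otimes>\<^bsub>A\<^esub> \<nu>}"
      unfolding g.edges_def by (auto simp: doubleton_eq_iff)
    have carr: "\<mu> \<in> carrier A" "\<nu> \<in> carrier A" using \<mu>\<nu> by (auto simp: g.weights_def)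
    then interpret A: comm_group A using grading by (simp add: g.grading_def)
    have prod: "b x y \<in> V (\<mu> \<otimes>\<^bsub>A\<^esub> \<nu>)"
      using grading carr \<mu>\<nu> by (auto simp: g.grading_def)
    then have prod_weight: "\<mu> \<otimes>\<^bsub>A\<^esub> \<nu> \<in> g.weights A V"
      using \<mu>\<nu>(5) carr by (auto simp: g.weights_def)
    have only1: "b x y \<in> range i1 \<Longrightarrow> \<mu> \<otimes>\<^bsub>A\<^esub> \<nu> \<in> ?\<Omega>1"
      using in2[OF _ prod] \<mu>\<nu>(5) prod_weight union
      by (auto simp: i1_simps) (metis p1_i1 p1_i2 i1_simps(3))
    have only2: "b x y \<in> range i2 \<Longrightarrow> \<mu> \<otimes>\<^bsub>A\<^esub> \<nu> \<in> ?\<Omega>2"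
      using in1[OF _ prod] \<mu>\<nu>(5) prod_weight union
      by (auto simp: i2_simps) (metis p2_i1 p2_i2 i2_simps(3))
    consider "\<mu> \<in> ?\<Omega>1" "\<nu> \<in> ?\<Omega>1" | "\<mu> \<in> ?\<Omega>2" "\<nu> \<in> ?\<Omega>2"
      | "\<mu> \<in> ?\<Omega>1" "\<nu> \<in> ?\<Omega>2" | "\<mu> \<in> ?\<Omega>2" "\<nu> \<in> ?\<Omega>1"
      using \<mu>\<nu>(1,2) union by blast
    then show False
    proof cases
      case 1
      then obtain u where "x = i1 u" using in1 \<mu>\<nu>(3) by blast
      then have "b x y \<in> range i1" by (simp add: bracket_i1_left)
      then show False using only1 1 sub \<alpha>\<beta>(2) disjoint by blast
    next
      case 2
      then obtain w where "x = i2 w" using in2 \<mu>\<nu>(3) by blast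
      then have "b x y \<in> range i2" by (simp add: f.bracket_i1_left)
      then show False using only2 2 sub \<alpha>\<beta>(1) disjoint by blast
    next
      case 3
      then obtain u w where "x = i1 u" "y = i2 w" using in1 in2 \<mu>\<nu>(3,4) by blast
      then show False using \<mu>\<nu>(5) by (simp add: bracket_i1_left)
    next
      case 4
      then obtain u w where "y = i1 u" "x = i2 w" using in1 in2 \<mu>\<nu>(3,4) by blast
      then show False using \<mu>\<nu>(5) by (simp add: bracket_i1_right)
    qed
  qed
  have ideals: "g.direct_product_of_ideals (range i1) (range i2)"
    unfolding g.direct_product_of_ideals_def
  proof (intro conjI ideal_range_i1 f.ideal_range_i1 allI)
    have "z = 0" if "z \<in> range i1" "z \<in> range i2" for z
    proof -
      have "p2 z = 0" using that(1) by auto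
      moreover have "p1 z = 0" using that(2) by auto
      ultimately show ?thesis using decomposition[of z] by (simp add: i1_simps i2_simps)
    qed
    then show "range i1 \<inter> range i2 = {0}"
      using i1_simps(3) i2_simps(3) by (auto simp: image_iff)
    show "\<exists>y\<in>range i1. \<exists>z\<in>range i2. x = y + z" for x
      using decomposition[of x] by (metis rangeI)
  qed
  show ?thesis
    by (rule exI[of _ ?\<Omega>1], rule exI[of _ ?\<Omega>2])
      (use union disjoint no_edge ideals isomorphic_range_i1 f.isomorphic_range_i1 in
        \<open>auto simp: sum1 sum2\<close>)
qed

end

theorem proposition4p3:
  fixes scale\<^sub>1 :: "'k::field_char_0 \<Rightarrow> 'a::ab_group_add \<Rightarrow> 'a"
    and bracket\<^sub>1 :: "'a \<Rightarrow> 'a \<Rightarrow> 'a"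
    and scale\<^sub>2 :: "'k \<Rightarrow> 'b::ab_group_add \<Rightarrow> 'b"
    and bracket\<^sub>2 :: "'b \<Rightarrow> 'b \<Rightarrow> 'b"
    and scale :: "'k \<Rightarrow> 'a \<times> 'b \<Rightarrow> 'a \<times> 'b"
    and bracket :: "'a \<times> 'b \<Rightarrow> 'a \<times> 'b \<Rightarrow> 'a \<times> 'b"
    and A :: "'u::infinite monoid"
    and V :: "'u \<Rightarrow> ('a \<times> 'b) set"
  assumes "lie_algebra scale\<^sub>1 bracket\<^sub>1"
    and "lie_algebra scale\<^sub>2 bracket\<^sub>2"
    and "\<exists>Basis. finite_dimensional_vector_space scale\<^sub>1 Basis"
    and "\<exists>Basis. finite_dimensional_vector_space scale\<^sub>2 Basis"
    and "\<exists>x::'a. x \<noteq> 0"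
    and "\<exists>x::'b. x \<noteq> 0"
    and "scale = module_prod.scale scale\<^sub>1 scale\<^sub>2"
    and "bracket = prod_bracket bracket\<^sub>1 bracket\<^sub>2"
    and zero_not_weight\<^sub>1:
      "\<And>(A\<^sub>1::'u monoid) V\<^sub>1. lie_algebra.maximal_grading scale\<^sub>1 bracket\<^sub>1 A\<^sub>1 V\<^sub>1 \<Longrightarrow>
         \<one>\<^bsub>A\<^sub>1\<^esub> \<notin> lie_algebra.weights A\<^sub>1 V\<^sub>1"
    and zero_not_weight\<^sub>2:
      "\<And>(A\<^sub>2::'u monoid) V\<^sub>2. lie_algebra.maximal_grading scale\<^sub>2 bracket\<^sub>2 A\<^sub>2 V\<^sub>2 \<Longrightarrow>
         \<one>\<^bsub>A\<^sub>2\<^esub> \<notin> lie_algebra.weights A\<^sub>2 V\<^sub>2"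
    and no_torsion:
      "(\<forall>(A\<^sub>1::'u monoid) V\<^sub>1. lie_algebra.maximal_grading scale\<^sub>1 bracket\<^sub>1 A\<^sub>1 V\<^sub>1 \<longrightarrow>
          lie_algebra.no_nonzero_torsion_weight A\<^sub>1 V\<^sub>1) \<or>
       (\<forall>(A\<^sub>2::'u monoid) V\<^sub>2. lie_algebra.maximal_grading scale\<^sub>2 bracket\<^sub>2 A\<^sub>2 V\<^sub>2 \<longrightarrow>
          lie_algebra.no_nonzero_torsion_weight A\<^sub>2 V\<^sub>2)"
    and "lie_algebra.maximal_grading scale bracket A V"
  shows "\<exists>\<Omega>\<^sub>1 \<Omega>\<^sub>2.
    lie_algebra.weights A V = \<Omega>\<^sub>1 \<union> \<Omega>\<^sub>2 \<and> \<Omega>\<^sub>1 \<inter> \<Omega>\<^sub>2 = {} \<and>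
    (\<forall>\<alpha>\<in>\<Omega>\<^sub>1. \<forall>\<beta>\<in>\<Omega>\<^sub>2. {\<alpha>, \<beta>} \<notin> lie_algebra.edges bracket A V) \<and>
    lie_algebra.direct_product_of_ideals scale bracket
      (lie_algebra.sum_of_layers scale V \<Omega>\<^sub>1) (lie_algebra.sum_of_layers scale V \<Omega>\<^sub>2) \<and>
    lie_isomorphic_to_ideal scale\<^sub>1 bracket\<^sub>1 scale bracket
      (lie_algebra.sum_of_layers scale V \<Omega>\<^sub>1) \<and>
    lie_isomorphic_to_ideal scale\<^sub>2 bracket\<^sub>2 scale bracket
      (lie_algebra.sum_of_layers scale V \<Omega>\<^sub>2)"
proof -
  note scale_def = assms(7) and bracket_def = assms(8)
  obtain B\<^sub>1 where fd\<^sub>1: "finite_dimensional_vector_space scale\<^sub>1 B\<^sub>1" using assms(3) by blast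
  obtain B\<^sub>2 where fd\<^sub>2: "finite_dimensional_vector_space scale\<^sub>2 B\<^sub>2" using assms(4) by blast
  interpret g1: fd_lie_algebra scale\<^sub>1 bracket\<^sub>1 B\<^sub>1
    using assms(1) fd\<^sub>1 by (rule fd_lie_algebra.intro)
  interpret g2: fd_lie_algebra scale\<^sub>2 bracket\<^sub>2 B\<^sub>2
    using assms(2) fd\<^sub>2 by (rule fd_lie_algebra.intro)
  interpret prod: finite_dimensional_vector_space_prod scale\<^sub>1 scale\<^sub>2 B\<^sub>1 B\<^sub>2
    by unfold_locales
  have fd: "finite_dimensional_vector_space scale prod.Basis_pair"
    unfolding scale_def by (rule prod.p.finite_dimensional_vector_space_axioms)
  interpret g: fd_lie_algebra scale bracket prod.Basis_pair
    using lie_algebra_prod[OF assms(1,2)] fd unfolding scale_def bracket_def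
    by (rule fd_lie_algebra.intro)
  have scale: "scale c (x, y) = (scale\<^sub>1 c x, scale\<^sub>2 c y)" for c x y
    by (simp add: scale_def prod.scale_def)
  have bracket: "bracket (x, y) (x', y') = (bracket\<^sub>1 x x', bracket\<^sub>2 y y')" for x y x' y'
    by (simp add: bracket_def prod_bracket_def)
  obtain T where T: "g.maximal_split_torus T"
    "g.universal_realization (g.dual_group T) (g.torus_layer T) A V"
    using assms(12) by (auto simp: g.maximal_grading_def)
  obtain E where "torus_family scale bracket prod.Basis_pair T E"
    using g.split_torus_basis T(1) g.maximal_split_torus_def by blast
  then interpret T: torus_family scale bracket prod.Basis_pair T E .
  define e where "e z = (fst z, 0 :: 'b)" for z :: "'a \<times> 'b"
  have "e \<in> g.centroid"
    by (auto simp: g.centroid_def e_def scale bracket intro!: g.linI)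
  moreover have "e (e z) = e z" for z by (simp add: e_def)
  ultimately obtain \<Phi> \<Phi>' where \<Phi>: "g.inverse_automorphisms \<Phi> \<Phi>'"
    and commute: "\<And>D z. D \<in> T \<Longrightarrow> D (\<Phi> (e (\<Phi>' z))) = \<Phi> (e (\<Phi>' (D z)))"
    using T.conjugate_idempotent by blast
  have lin: "g.lin \<Phi>" "g.lin \<Phi>'" and inv: "\<Phi> (\<Phi>' z) = z" "\<Phi>' (\<Phi> z) = z"
    and hom: "\<Phi> (bracket z w) = bracket (\<Phi> z) (\<Phi> w)" for z w
    using \<Phi> unfolding g.inverse_automorphisms_def by blast+
  have hom': "\<Phi>' (bracket z w) = bracket (\<Phi>' z) (\<Phi>' w)" for z w
    by (metis hom inv)
  note \<Phi>_simps = linear_facts[OF lin(1)] and \<Phi>'_simps = linear_facts[OF lin(2)]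
  have \<Phi>_scale: "\<Phi> (scale\<^sub>1 c x, 0) = scale c (\<Phi> (x, 0))" "\<Phi> (0, scale\<^sub>2 c y) = scale c (\<Phi> (0, y))" for c x y
    by (simp_all add: scale flip: \<Phi>_simps(2))
  have fst_scale: "fst (scale c z) = scale\<^sub>1 c (fst z)" and snd_scale: "snd (scale c z) = scale\<^sub>2 c (snd z)" for c z
    by (simp_all add: scale_def prod.scale_def)
  \<comment> \<open>The given product moved by \<Phi>: the projection onto its first factor is the
    conjugate of \<open>e\<close>, which commutes with \<open>T\<close>.\<close>
  interpret P: lie_product scale bracket prod.Basis_pair scale\<^sub>1 bracket\<^sub>1 B\<^sub>1 scale\<^sub>2 bracket\<^sub>2 B\<^sub>2
    "\<lambda>x. \<Phi> (x, 0)" "\<lambda>z. fst (\<Phi>' z)" "\<lambda>y. \<Phi> (0, y)" "\<lambda>z. snd (\<Phi>' z)"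
  proof (rule lie_product.intro[OF g.fd_lie_algebra_axioms g1.fd_lie_algebra_axioms
        g2.fd_lie_algebra_axioms], rule lie_product_axioms.intro)
    show "Vector_Spaces.linear scale\<^sub>1 scale (\<lambda>x. \<Phi> (x, 0))"
      "Vector_Spaces.linear scale\<^sub>2 scale (\<lambda>y. \<Phi> (0, y))"
      "Vector_Spaces.linear scale scale\<^sub>1 (\<lambda>z. fst (\<Phi>' z))"
      "Vector_Spaces.linear scale scale\<^sub>2 (\<lambda>z. snd (\<Phi>' z))"
      using g1.vector_space_axioms g2.vector_space_axioms g.vector_space_axioms
      by (auto simp: Vector_Spaces.linear_iff \<Phi>'_simps(1,2) \<Phi>_scale fst_scale snd_scale
          simp flip: \<Phi>_simps(1))
    show "\<Phi> (fst (\<Phi>' z), 0) + \<Phi> (0, snd (\<Phi>' z)) = z" for z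
      by (simp add: inv flip: \<Phi>_simps(1))
    show "fst (\<Phi>' (bracket z w)) = bracket\<^sub>1 (fst (\<Phi>' z)) (fst (\<Phi>' w))"
      "snd (\<Phi>' (bracket z w)) = bracket\<^sub>2 (snd (\<Phi>' z)) (snd (\<Phi>' w))" for z w
      unfolding hom' by (simp_all add: bracket_def prod_bracket_def)
  qed (simp_all add: inv)
  interpret P': lie_product scale bracket prod.Basis_pair scale\<^sub>2 bracket\<^sub>2 B\<^sub>2 scale\<^sub>1 bracket\<^sub>1 B\<^sub>1
    "\<lambda>y. \<Phi> (0, y)" "\<lambda>z. snd (\<Phi>' z)" "\<lambda>x. \<Phi> (x, 0)" "\<lambda>z. fst (\<Phi>' z)"
    by (rule P.flip)
  have invariant: "D (\<Phi> (fst (\<Phi>' z), 0)) = \<Phi> (fst (\<Phi>' (D z)), 0)" if "D \<in> T" for D z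
    using commute[OF that, of z] by (simp add: e_def)
  \<comment> \<open>The second projection is the identity minus the first, so it commutes with
    \<open>T\<close> too.\<close>
  have invariant': "D (\<Phi> (0, snd (\<Phi>' z))) = \<Phi> (0, snd (\<Phi>' (D z)))" if D: "D \<in> T" for D z
  proof -
    have "D (\<Phi> (fst (\<Phi>' z), 0) + \<Phi> (0, snd (\<Phi>' z))) = D z"
      by (simp only: P.decomposition)
    then have "\<Phi> (fst (\<Phi>' (D z)), 0) + D (\<Phi> (0, snd (\<Phi>' z))) = D z"
      using linear_facts(1)[OF T.lin_F[OF D]] by (simp add: invariant[OF D])
    also have "\<dots> = \<Phi> (fst (\<Phi>' (D z)), 0) + \<Phi> (0, snd (\<Phi>' (D z)))"
      by (simp only: P.decomposition)
    finally show ?thesis by simp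
  qed
  have unmixed_layer: "fst (\<Phi>' v) = 0 \<or> snd (\<Phi>' v) = 0" if v: "v \<in> g.torus_layer T \<gamma>" for v \<gamma>
  proof (rule ccontr)
    assume "\<not> ?thesis"
    then have nz: "fst (\<Phi>' v) \<noteq> 0" "snd (\<Phi>' v) \<noteq> 0" by auto
    obtain U :: "'u monoid" and W where U: "g1.maximal_grading U W"
      "\<one>\<^bsub>U\<^esub> \<in> g1.weights U W \<or> \<not> g1.no_nonzero_torsion_weight U W"
      using P.mixed_vector_torsion_weight[OF T(1) invariant v nz] by blast
    obtain U' :: "'u monoid" and W' where U': "g2.maximal_grading U' W'"
      "\<one>\<^bsub>U'\<^esub> \<in> g2.weights U' W' \<or> \<not> g2.no_nonzero_torsion_weight U' W'"
      using P'.mixed_vector_torsion_weight[OF T(1) invariant' v nz(2,1)] by blast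
    \<comment> \<open>Zero is not a weight of either maximal grading, so both would have a
      non-trivial torsion weight, while \<open>no_torsion\<close> rules this out for at least one of
      the factors.\<close>
    show False
      using no_torsion U U' zero_not_weight\<^sub>1[OF U(1)] zero_not_weight\<^sub>2[OF U'(1)] by blast
  qed
  have real: "g.realization (g.dual_group T) (g.torus_layer T) A V"
    using T(2) by (simp add: g.universal_realization_def)
  then have grading: "g.grading A V" by (simp add: g.realization_def)
  \<comment> \<open>A realization only renames the torus layers and is zero elsewhere, so the
    statement about torus layers passes to \<open>V\<close>.\<close>
  have "fst (\<Phi>' v) = 0 \<or> snd (\<Phi>' v) = 0" if \<alpha>: "\<alpha> \<in> carrier A" and v: "v \<in> V \<alpha>" for \<alpha> v
  proof -
    obtain f where f: "\<forall>\<gamma>\<in>g.weights (g.dual_group T) (g.torus_layer T). V (f \<gamma>) = g.torus_layer T \<gamma>"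
      "\<forall>\<beta>\<in>carrier A - f ` g.weights (g.dual_group T) (g.torus_layer T). V \<beta> = {0}"
      using real by (auto simp: g.realization_def)
    show ?thesis
    proof (cases "\<alpha> \<in> f ` g.weights (g.dual_group T) (g.torus_layer T)")
      case True
      then obtain \<gamma> where \<gamma>: "\<gamma> \<in> g.weights (g.dual_group T) (g.torus_layer T)" "\<alpha> = f \<gamma>" by blast
      then have "v \<in> g.torus_layer T \<gamma>" using f(1) v by simp
      then show ?thesis by (rule unmixed_layer)
    next
      case False
      then have "v = 0" using f(2) \<alpha> v by auto
      then show ?thesis by (simp add: \<Phi>'_simps)
    qed
  qed
  then have "\<forall>\<alpha>\<in>carrier A. \<forall>v\<in>V \<alpha>. fst (\<Phi>' v) = 0 \<or> snd (\<Phi>' v) = 0"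
    by blast
  with grading show ?thesis by (rule P.product_detected)
qed

end
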